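(* Let $k, \ell$ be positive integers such that $k \geq \ell+2$. Then there exists a constant $c>0$ (depending only on $k$ and $\ell$) such that the following holds. Let $A$ and $B$ be systems of linear equations for which both of their underlying matrices are irredundant, partition regular, and of full rank, and whose cores $C(A)$ and $C(B)$ are both of dimension $\ell \times k$. If $p=p(n)$ satisfies $$p \leq c\,n^{-1/m(A,B)}=c\,n^{-\frac{k-\ell-1}{k-1}},$$ then $$\lim_{n \to \infty} \mathbb{P}\big[\, [n]_p \text{ is } (A,B)\text{-Rado}\,\big]=0.$$
   Context: $\mathbb{N}$ is the set of positive integers and $[n]:=\{1,\dots,n\}$. The random set $[n]_p$ is obtained by including each element of $[n]$ with probability $p$, independently of all other elements. A system of linear equations has the form $Mx=b$ with $M$ an integer matrix, called the underlying matrix of the system, and $b$ an integer vector (possibly zero). For a set $S$ of integers, a $q$-distinct solution in $S$ of a system in $q$ variables is a solution $x=(x_1,\dots,x_q)\in S^q$ with pairwise distinct entries. An integer matrix $M$ with $q$ columns is irredundant if $Mx=0$ has a $q$-distinct solution in $\mathbb{N}$; it is partition regular if for every finite colouring of $\mathbb N$ there is a monochromatic solution to $Mx=0$ (entries not required to be distinct). If $A$ and $B$ are systems in $k_A$ and $k_B$ variables respectively, a set $S$ of integers is $(A,B)$-Rado if for every colouring of $S$ with colours $1$ and $2$ there is either a $k_A$-distinct solution of $A$ in $S$ all of whose entries have colour $1$, or a $k_B$-distinct solution of $B$ in $S$ all of whose entries have colour $2$. For an integer matrix $M$ with columns indexed by $[q]$ and a partition $[q]=W\,\dot\cup\,\overline{W}$,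 let $M_{\overline{W}}$ be the matrix obtained from $M$ by restricting to the columns indexed by $\overline W$, with $\operatorname{rank}(M_{\overline{W}})=0$ if $\overline W=\emptyset$. Define $$m(M):=\max_{\substack{W \dot{\cup} \overline{W} = [q] \\ |W|\geq 2}} \frac{|W|-1}{|W|-1+\operatorname{rank}(M_{\overline{W}})-\operatorname{rank}(M)},$$ and for integer matrices $M,N$, where $M$ has $q$ columns, $$m(M,N):= \max_{\substack{W \dot\cup \overline{W} = [q]\\ |W| \geq 2}} \frac{|W|}{|W|-1+\operatorname{rank}(M_{\overline{W}})-\operatorname{rank}(M)+1/m(N)}.$$ For systems of linear equations $A$, $B$, the quantities $m(A)$ and $m(A,B)$ are those of the underlying matrices. An $\ell\times k$ matrix $M$ of full rank is strictly balanced if for every $W\subseteq[k]$ with $2\le |W|<k$, $$\frac{|W|-1}{|W|-1+\operatorname{rank}(M_{\overline{W}})-\ell} < \frac{k-1}{k-1-\ell}.$$ Given an irredundant partition regular matrix $M$, a core $C(M)$ is a matrix obtained from $M$ by deleting rows and columns of $M$, such that $m(C(M))=m(M)$, which is irredundant, of full rank and strictly balanced (a core always exists). For a system of linear equations $A$, $C(A)$ denotes a core of the underlying matrix of $A$. *)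

theory Defs
  imports
    "HOL-Probability.Probability"
    "Jordan_Normal_Form.DL_Rank"
    "Jordan_Normal_Form.DL_Submatrix"
begin

text \<open>A system \<open>(M, b)\<close> stands for the equations \<open>M x = b\<close>. Rows, columns and entries are
  numbered from 0, so the index set of the columns is \<open>{..<dim_col M}\<close>.\<close>

type_synonym lin_system = "int mat \<times> int vec"

definition linear_system :: "lin_system \<Rightarrow> bool" where
  "linear_system A \<longleftrightarrow> dim_vec (snd A) = dim_row (fst A)"

definition solution_in :: "lin_system \<Rightarrow> int set \<Rightarrow> int vec \<Rightarrow> bool" where
  "solution_in A S x \<longleftrightarrow>
     x \<in> carrier_vec (dim_col (fst A)) \<and> vec_set x \<subseteq> S \<and> fst A *\<^sub>v x = snd A"

definition distinct_solution_in :: "lin_system \<Rightarrow> int set \<Rightarrow> int vec \<Rightarrow> bool" where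
  "distinct_solution_in A S x \<longleftrightarrow> solution_in A S x \<and> inj_on (\<lambda>i. x $ i) {..<dim_vec x}"

definition irredundant :: "int mat \<Rightarrow> bool" where
  "irredundant M \<longleftrightarrow> (\<exists>x. distinct_solution_in (M, 0\<^sub>v (dim_row M)) {1..} x)"

definition partition_regular :: "int mat \<Rightarrow> bool" where
  "partition_regular M \<longleftrightarrow>
     (\<forall>\<kappa> :: int \<Rightarrow> nat. finite (\<kappa> ` {1..}) \<longrightarrow>
        (\<exists>x r. solution_in (M, 0\<^sub>v (dim_row M)) {s. 1 \<le> s \<and> \<kappa> s = r} x))"

definition rado :: "lin_system \<Rightarrow> lin_system \<Rightarrow> int set \<Rightarrow> bool" where
  "rado A B S \<longleftrightarrow>
     (\<forall>\<kappa> :: int \<Rightarrow> nat. (\<forall>s\<in>S. \<kappa> s \<in> {1, 2}) \<longrightarrow>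
        (\<exists>x. distinct_solution_in A {s \<in> S. \<kappa> s = 1} x) \<or>
        (\<exists>x. distinct_solution_in B {s \<in> S. \<kappa> s = 2} x))"

definition mat_rank :: "int mat \<Rightarrow> nat" where
  "mat_rank M = vec_space.rank (dim_row M) (map_mat rat_of_int M)"

definition full_rank :: "int mat \<Rightarrow> bool" where
  "full_rank M \<longleftrightarrow> mat_rank M = min (dim_row M) (dim_col M)"

text \<open>The matrix obtained from \<open>M\<close> by keeping the columns outside \<open>W\<close>. It has no columns,
  and hence rank 0, if \<open>W\<close> contains all of them.\<close>

definition restrict_compl :: "int mat \<Rightarrow> nat set \<Rightarrow> int mat" where
  "restrict_compl M W = submatrix M UNIV ({..<dim_col M} - W)"

lemma mat_rank_no_cols:
  assumes "dim_col M = 0"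
  shows "mat_rank M = 0"
proof -
  have "vec_space.rank (dim_row M) (map_mat rat_of_int M) \<le> dim_col M"
    by (rule vec_space.rank_le_nc) auto
  then show ?thesis using assms by (simp add: mat_rank_def)
qed

lemma mat_rank_restrict_compl_all: "mat_rank (restrict_compl M {..<dim_col M}) = 0"
  by (rule mat_rank_no_cols) (simp add: restrict_compl_def dim_submatrix)

text \<open>The denominators below are real, so the difference of ranks, which is never positive, is not
  truncated. They are positive if \<open>M\<close> is irredundant and partition regular. If \<open>M\<close> has fewer
  than two columns, the maximum is over the empty set and carries no meaning.\<close>

definition m_single :: "int mat \<Rightarrow> real" where
  "m_single M = Max ((\<lambda>W. (real (card W) - 1) /
       (real (card W) - 1 + real (mat_rank (restrict_compl M W)) - real (mat_rank M)))
     ` {W. W \<subseteq> {..<dim_col M} \<and> 2 \<le> card W})"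

definition m_pair :: "int mat \<Rightarrow> int mat \<Rightarrow> real" where
  "m_pair M N = Max ((\<lambda>W. real (card W) /
       (real (card W) - 1 + real (mat_rank (restrict_compl M W)) - real (mat_rank M)
          + 1 / m_single N))
     ` {W. W \<subseteq> {..<dim_col M} \<and> 2 \<le> card W})"

definition strictly_balanced :: "int mat \<Rightarrow> bool" where
  "strictly_balanced M \<longleftrightarrow> full_rank M \<and>
     (\<forall>W. W \<subseteq> {..<dim_col M} \<and> 2 \<le> card W \<and> card W < dim_col M \<longrightarrow>
        (real (card W) - 1) /
          (real (card W) - 1 + real (mat_rank (restrict_compl M W)) - real (dim_row M))
        < (real (dim_col M) - 1) / (real (dim_col M) - 1 - real (dim_row M)))"

text \<open>\<open>I\<close> and \<open>J\<close> are the rows and columns that are not deleted. A matrix can have several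
  cores, so being a core is a relation.\<close>

definition is_core :: "int mat \<Rightarrow> int mat \<Rightarrow> bool" where
  "is_core M C \<longleftrightarrow>
     (\<exists>I J. I \<subseteq> {..<dim_row M} \<and> J \<subseteq> {..<dim_col M} \<and> C = submatrix M I J) \<and>
     m_single C = m_single M \<and> irredundant C \<and> full_rank C \<and> strictly_balanced C"

text \<open>The distribution of \<open>[n]\<^sub>p\<close>, for \<open>0 \<le> p \<le> 1\<close>.\<close>

definition random_subset :: "nat \<Rightarrow> real \<Rightarrow> int set pmf" where
  "random_subset n p =
     map_pmf (\<lambda>f. {i \<in> {1..int n}. f i}) (Pi_pmf {1..int n} False (\<lambda>_. bernoulli_pmf p))"

end

theory Submission
  imports Defs
begin

text \<open>
  Put \<open>\<mu> = l / (k - 1)\<close>, so that \<open>p\<close> is at most a small constant times \<open>n\<close> to the power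
  \<open>-(1 - \<mu>)\<close>. The proof is a first-moment argument: a set that is Rado for the two systems contains a
  configuration of solutions so dense that a random set is unlikely to contain one.

  For a set \<open>W\<close> of columns of \<open>M\<close> let \<open>proj_dim M W\<close> be the dimension of the projection of the kernel
  of \<open>M\<close> to the coordinates in \<open>W\<close>. Then \<open>m_single M\<close> is the maximum of
  \<open>(|W| - 1) / (proj_dim M W - 1)\<close> over \<open>|W| \<ge> 2\<close>; the denominators are positive because two
  coordinates of the solutions of an irredundant partition regular system are not proportional
  (\<open>proj_dim_small\<close>). The cores give \<open>m_single = 1 / (1 - \<mu>)\<close> for both systems, and \<open>m_pair\<close> then has the
  same value (\<open>m_pair_balanced\<close>). A smallest set \<open>W\<close> at which the maximum is attained is
  \<open>balanced\<close> (\<open>exists_balanced\<close>). An edge is the set of values on \<open>W\<close> of a solution in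
  \<open>{1..n}\<close> with distinct entries. If \<open>r\<close> values of an edge are prescribed, at positions \<open>R\<close>, the expected
  number of ways in which the random set contains the rest of the edge is at most a constant times \<open>n\<close> to
  the power
  \<open>|R| - proj_dim M R - \<mu> (|R| - 1)\<close>. This exponent is \<open>\<mu>\<close> for \<open>r = 0\<close>, it is \<open>0\<close> for \<open>r = 1\<close> (with a
  small constant), it is \<open>-\<mu>\<close> for \<open>r = 2\<close>, and it is negative whenever \<open>2 \<le> r < |W|\<close>
  (\<open>balanced_degrees\<close>). So a single edge contributes \<open>n\<close> to the power \<open>\<mu>\<close>, edges that are glued on at a single vertex
  contribute small constants, an edge that closes a cycle by meeting two earlier vertices cancels the initial \<open>\<mu>\<close>, and
  one further overlap makes the expectation tend to 0 (\<open>weight_dense\<close>).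

  It remains to find such a configuration, a dense list, whenever the edges inside the set cannot be coloured
  without a red edge of the first system or a blue edge of the second (\<open>not_colourable_dense\<close>). In a
  minimal uncolourable family, each vertex \<open>v\<close> of each edge \<open>e\<close> lies on an edge of the other system
  that meets \<open>e\<close> in \<open>v\<close> only. Following such partners from the end of a longest loose path
  closes up to a loose cycle, unless there is a dense list. From then on, without dense lists, everything
  is rigid: an edge that meets the cycle is contained in its vertex set, and a shortest cycle together with a
  partner of one of its edges consists of the four lines of a complete quadrilateral, three points on each.
  The six points of this configuration can be recoloured independently of the rest.

  Since \<open>k\<close> and \<open>l\<close> enter only through \<open>\<mu>\<close>, the bounds have to be uniform in the size of \<open>W\<close>. This is why
  the constant has to beat a number of choices that is exponential in the size of the edges; \<open>c = 1 / 64\<close> does so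
  for all \<open>k\<close> and \<open>l\<close>.
\<close>


section \<open>Asymmetric colourings of set systems\<close>

text \<open>The two families of sets stand for the edges of the two systems: no member of \<open>\<A>\<close> may be
  entirely in the first colour, and no member of \<open>\<B>\<close> entirely in the second.\<close>

definition colourable :: "'a set set \<Rightarrow> 'a set set \<Rightarrow> bool" where
  "colourable \<A> \<B> \<longleftrightarrow> (\<exists>\<phi>. (\<forall>e\<in>\<A>. \<exists>v\<in>e. \<not> \<phi> v) \<and> (\<forall>e\<in>\<B>. \<exists>v\<in>e. \<phi> v))"

definition critical :: "'a set set \<Rightarrow> 'a set set \<Rightarrow> bool" where
  "critical \<A> \<B> \<longleftrightarrow> \<not> colourable \<A> \<B> \<and>
     (\<forall>e\<in>\<A>. colourable (\<A> - {e}) \<B>) \<and> (\<forall>e\<in>\<B>. colourable \<A> (\<B> - {e}))"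

lemma colourable_commute: "colourable \<A> \<B> \<longleftrightarrow> colourable \<B> \<A>"
proof -
  have "colourable \<B> \<A>" if "colourable \<A> \<B>" for \<A> \<B> :: "'a set set"
  proof -
    from that obtain \<phi> where "\<forall>e\<in>\<A>. \<exists>v\<in>e. \<not> \<phi> v" "\<forall>e\<in>\<B>. \<exists>v\<in>e. \<phi> v"
      unfolding colourable_def by blast
    then show ?thesis unfolding colourable_def by (intro exI[of _ "\<lambda>v. \<not> \<phi> v"]) auto
  qed
  then show ?thesis by blast
qed

lemma critical_commute: "critical \<A> \<B> \<longleftrightarrow> critical \<B> \<A>"
  unfolding critical_def using colourable_commute by blast

lemma ex_critical:
  assumes "finite \<A>" "finite \<B>" "\<not> colourable \<A> \<B>"
  shows "\<exists>\<A>'\<subseteq>\<A>. \<exists>\<B>'\<subseteq>\<B>. critical \<A>' \<B>'"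
  using assms
proof (induction "card \<A> + card \<B>" arbitrary: \<A> \<B> rule: less_induct)
  case less
  show ?case
  proof (cases "critical \<A> \<B>")
    case False
    then consider e where "e \<in> \<A>" "\<not> colourable (\<A> - {e}) \<B>"
      | e where "e \<in> \<B>" "\<not> colourable \<A> (\<B> - {e})"
      using less.prems(3) unfolding critical_def by blast
    then show ?thesis
    proof cases
      case 1
      then have "card (\<A> - {e}) < card \<A>" using less.prems by (intro psubset_card_mono) auto
      then obtain \<A>' \<B>' where "\<A>' \<subseteq> \<A> - {e}" "\<B>' \<subseteq> \<B>" "critical \<A>' \<B>'"
        using less.hyps[of "\<A> - {e}" \<B>] less.prems 1 by auto
      then show ?thesis by blast
    next
      case 2
      then have "card (\<B> - {e}) < card \<B>" using less.prems by (intro psubset_card_mono) auto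
      then obtain \<A>' \<B>' where "\<A>' \<subseteq> \<A>" "\<B>' \<subseteq> \<B> - {e}" "critical \<A>' \<B>'"
        using less.hyps[of \<A> "\<B> - {e}"] less.prems 2 by auto
      then show ?thesis by blast
    qed
  qed blast
qed

text \<open>Colour everything except \<open>e\<close>. As \<open>e\<close> cannot be added, it has only the forbidden colour.
  Changing the colour of \<open>v\<close> repairs \<open>e\<close>, so it must spoil a member of the other family; that one
  has, apart from \<open>v\<close>, only vertices of the colour that \<open>e\<close> does not use.\<close>

lemma critical_partner:
  assumes "critical \<A> \<B>" "e \<in> \<A>" "v \<in> e"
  shows "\<exists>f\<in>\<B>. f \<inter> e = {v}"
proof -
  have "colourable (\<A> - {e}) \<B>" using assms by (simp add: critical_def)
  then obtain \<phi> where \<phi>: "\<forall>d\<in>\<A> - {e}. \<exists>v\<in>d. \<not> \<phi> v" "\<forall>d\<in>\<B>. \<exists>v\<in>d. \<phi> v"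
    unfolding colourable_def by blast
  have nc: "\<not> colourable \<A> \<B>" using assms by (simp add: critical_def)
  have e: "\<forall>u\<in>e. \<phi> u"
  proof (rule ccontr)
    assume "\<not> (\<forall>u\<in>e. \<phi> u)"
    then have "\<exists>v\<in>d. \<not> \<phi> v" if "d \<in> \<A>" for d
      using \<phi>(1) that by (cases "d = e") auto
    then have "colourable \<A> \<B>" using \<phi>(2) unfolding colourable_def by (intro exI[of _ \<phi>]) simp
    then show False using nc by simp
  qed
  define \<psi> where "\<psi> = \<phi>(v := False)"
  have "\<forall>d\<in>\<A>. \<exists>v\<in>d. \<not> \<psi> v" using \<phi>(1) assms by (auto simp: \<psi>_def)
  then have "\<not> (\<forall>d\<in>\<B>. \<exists>v\<in>d. \<psi> v)" using nc unfolding colourable_def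
    by (intro notI) (erule notE, intro exI[of _ \<psi>] conjI)
  then obtain f where f: "f \<in> \<B>" "\<forall>u\<in>f. \<not> \<psi> u" by blast
  have "f \<inter> e = {v}"
  proof -
    obtain u where u: "u \<in> f" "\<phi> u" using \<phi>(2) f(1) by blast
    then have "u = v" using f(2) by (metis \<psi>_def fun_upd_apply)
    moreover have "\<not> (u \<in> f \<and> u \<in> e)" if "u \<noteq> v" for u
      using that f(2) e by (auto simp: \<psi>_def)
    ultimately show ?thesis using u assms by blast
  qed
  with f show ?thesis by blast
qed


section \<open>Lists of edges with few overlaps\<close>

text \<open>Lists of edges grow at the head. In a loose extension each new edge has exactly one vertex in common with all
  earlier edges together, and this vertex lies on the edge added just before.\<close>

inductive_set loose_ext :: "'a set set \<Rightarrow> 'a set list set \<Rightarrow> 'a set list set"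
  for H X where
  base: "es \<in> X \<Longrightarrow> es \<in> loose_ext H X"
| step: "es \<in> loose_ext H X \<Longrightarrow> f \<in> H \<Longrightarrow> f \<inter> \<Union>(set es) = {v} \<Longrightarrow> v \<in> hd es
    \<Longrightarrow> f # es \<in> loose_ext H X"

text \<open>Here the new edge may meet the earlier ones anywhere, in a number of vertices that satisfies \<open>J\<close>, but it has
  to contribute a new vertex.\<close>

definition attach :: "'a set set \<Rightarrow> (nat \<Rightarrow> bool) \<Rightarrow> 'a set list set \<Rightarrow> 'a set list set" where
  "attach H J X = {f # es |f es. es \<in> X \<and> f \<in> H \<and>
     J (card (f \<inter> \<Union>(set es))) \<and> \<not> f \<subseteq> \<Union>(set es)}"

definition loose_paths :: "'a set set \<Rightarrow> 'a set list set" where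
  "loose_paths H = loose_ext H ((\<lambda>e. [e]) ` H)"

definition loose_cycles :: "'a set set \<Rightarrow> 'a set list set" where
  "loose_cycles H = attach H ((=) 2) (loose_paths H)"

text \<open>Three ways of having one overlap in two vertices and another one in at least two, the other edges being
  attached loosely: a loose path with two more edges, a loose cycle with one more edge, and a loose
  cycle followed by a loose path that starts anywhere on it and by one more edge.\<close>

definition dense_lists :: "'a set set \<Rightarrow> 'a set list set" where
  "dense_lists H = attach H ((=) 2) (attach H ((\<le>) 2) (loose_paths H))
     \<union> attach H ((\<le>) 2) (loose_cycles H)
     \<union> attach H ((\<le>) 2) (loose_ext H (attach H ((=) 1) (loose_cycles H)))"

lemma loose_ext_mono:
  assumes "H \<subseteq> H'" "X \<subseteq> X'"
  shows "loose_ext H X \<subseteq> loose_ext H' X'"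
proof
  fix es assume "es \<in> loose_ext H X"
  then show "es \<in> loose_ext H' X'"
    by induction (use assms in \<open>auto intro: loose_ext.intros\<close>)
qed

lemma attach_mono: "H \<subseteq> H' \<Longrightarrow> X \<subseteq> X' \<Longrightarrow> attach H J X \<subseteq> attach H' J X'"
  unfolding attach_def by blast

lemma dense_lists_mono:
  assumes "H \<subseteq> H'"
  shows "dense_lists H \<subseteq> dense_lists H'"
  unfolding dense_lists_def loose_cycles_def loose_paths_def
  by (intro Un_mono attach_mono loose_ext_mono assms image_mono)

lemma loose_ext_sets:
  assumes "\<And>es. es \<in> X \<Longrightarrow> set es \<subseteq> H" "es \<in> loose_ext H X"
  shows "set es \<subseteq> H"
  using assms(2,1) by induction auto

lemma attach_sets:
  assumes "\<And>es. es \<in> X \<Longrightarrow> set es \<subseteq> H" "es \<in> attach H J X"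
  shows "set es \<subseteq> H"
proof -
  from assms(2) obtain f fs where "es = f # fs" "fs \<in> X" "f \<in> H"
    unfolding attach_def by blast
  with assms(1)[of fs] show ?thesis by simp
qed

lemma loose_paths_sets: "es \<in> loose_paths H \<Longrightarrow> set es \<subseteq> H"
  unfolding loose_paths_def by (rule loose_ext_sets) auto

lemma loose_cycles_sets: "es \<in> loose_cycles H \<Longrightarrow> set es \<subseteq> H"
  unfolding loose_cycles_def by (rule attach_sets[OF loose_paths_sets])

lemma dense_lists_sets: "es \<in> dense_lists H \<Longrightarrow> set es \<subseteq> H"
  unfolding dense_lists_def
  using attach_sets[OF attach_sets[OF loose_paths_sets], where es = es]
    attach_sets[OF loose_cycles_sets, where es = es]
    attach_sets[OF loose_ext_sets[OF attach_sets[OF loose_cycles_sets]], where es = es]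
  by (elim UnE) simp_all

text \<open>Edges that are not neighbours in the list are disjoint. So an edge outside that meets only the first and the last
  edge of a segment closes a cycle with it, which need not hold for the members of \<open>loose_ext\<close>.\<close>

fun simple_path :: "'a set list \<Rightarrow> bool" where
  "simple_path [] \<longleftrightarrow> True"
| "simple_path [e] \<longleftrightarrow> True"
| "simple_path (f # e # es) \<longleftrightarrow>
     simple_path (e # es) \<and> is_singleton (f \<inter> e) \<and> f \<inter> \<Union>(set es) = {}"

lemma simple_path_tl: "simple_path (e # es) \<Longrightarrow> simple_path es"
  by (cases es) auto

lemma simple_path_append1: "simple_path (xs @ ys) \<Longrightarrow> simple_path xs"
proof (induction xs rule: simple_path.induct)
  case (3 f e es)
  then show ?case by auto
qed auto

lemma simple_path_hd:
  assumes "simple_path (f # es)" "es \<noteq> []"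
  obtains v where "v \<in> hd es" "f \<inter> \<Union>(set es) = {v}" "f \<inter> hd es = {v}"
proof -
  obtain e es' where es: "es = e # es'" using assms(2) by (cases es) auto
  with assms(1) obtain v where "f \<inter> e = {v}" "f \<inter> \<Union>(set es') = {}"
    by (auto elim: is_singletonE)
  then show ?thesis using that[of v] es by auto
qed

text \<open>A configuration \<open>c\<close> that is already there is treated as one large edge \<open>V\<close> at the end of a simple path. So
  paths and handles on a cycle obey the same lemmas.\<close>

lemma simple_path_loose_ext:
  assumes "simple_path (fs @ [V])" "fs \<noteq> []" "set fs \<subseteq> H" "c \<in> X" "\<Union>(set c) = V"
    "\<And>f. f \<in> H \<Longrightarrow> 2 \<le> card f"
  shows "fs @ c \<in> loose_ext H (attach H ((=) 1) X)"
  using assms(1-3)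
proof (induction fs)
  case (Cons f fs)
  show ?case
  proof (cases "fs = []")
    case True
    then obtain v where v: "f \<inter> V = {v}" using Cons.prems by (auto elim: is_singletonE)
    have "\<not> f \<subseteq> V"
    proof
      assume "f \<subseteq> V"
      then have "f = {v}" using v by blast
      then show False using assms(6)[of f] Cons.prems(3) by auto
    qed
    then show ?thesis using v Cons.prems assms True
      by (intro loose_ext.base) (auto simp: attach_def)
  next
    case False
    then have IH: "fs @ c \<in> loose_ext H (attach H ((=) 1) X)"
      using Cons simple_path_tl by fastforce
    have "simple_path (f # (fs @ [V]))" "fs @ [V] \<noteq> []" using Cons.prems by auto
    then obtain v where v: "v \<in> hd (fs @ [V])" "f \<inter> \<Union>(set (fs @ [V])) = {v}"
      by (rule simple_path_hd)
    have "f # (fs @ c) \<in> loose_ext H (attach H ((=) 1) X)"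
      using IH _ _ _
    proof (rule loose_ext.step)
      show "f \<in> H" using Cons.prems by simp
      show "f \<inter> \<Union>(set (fs @ c)) = {v}" using v(2) assms(5) by (auto simp: Int_Un_distrib Un_commute)
      show "v \<in> hd (fs @ c)" using v(1) False by simp
    qed
    then show ?thesis by simp
  qed
qed simp

lemma simple_path_loose_paths:
  assumes "simple_path es" "es \<noteq> []" "set es \<subseteq> H"
  shows "es \<in> loose_paths H"
  using assms
proof (induction es)
  case (Cons f es)
  show ?case
  proof (cases "es = []")
    case True
    then show ?thesis using Cons.prems by (auto simp: loose_paths_def intro: loose_ext.base)
  next
    case False
    then obtain v where "v \<in> hd es" "f \<inter> \<Union>(set es) = {v}"
      using Cons.prems(1) simple_path_hd by metis
    then show ?thesis using Cons False simple_path_tl[OF Cons.prems(1)]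
      by (auto simp: loose_paths_def intro: loose_ext.step)
  qed
qed simp

lemma simple_path_distinct:
  assumes "simple_path es" "\<And>e. e \<in> set es \<Longrightarrow> 2 \<le> card e"
  shows "distinct es"
  using assms
proof (induction es rule: simple_path.induct)
  case (3 f e es)
  have "f \<noteq> e"
  proof
    assume "f = e"
    then have "card f = 1" using "3.prems"(1) by (simp add: is_singleton_altdef)
    then show False using "3.prems"(2)[of f] by auto
  qed
  moreover have "f \<notin> set es"
  proof
    assume "f \<in> set es"
    then have "f = {}" using "3.prems"(1) by auto
    then show False using "3.prems"(2)[of f] by auto
  qed
  ultimately show ?case using 3 by auto
qed auto


section \<open>Loose cycles\<close>

text \<open>The edge \<open>g\<close> closes the simple path from \<open>e\<close> to \<open>f\<close>. The two vertices of \<open>g\<close> on the path are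
  required to be different, so that \<open>g\<close> does not merely pass through the common vertex of \<open>e\<close> and \<open>f\<close> when these
  are neighbours.\<close>

definition loose_cycle :: "'a set \<Rightarrow> 'a set list \<Rightarrow> 'a set \<Rightarrow> 'a set \<Rightarrow> bool" where
  "loose_cycle e ys f g \<longleftrightarrow> simple_path (e # ys @ [f]) \<and> g \<inter> \<Union>(set ys) = {} \<and>
     (\<exists>u w. u \<noteq> w \<and> g \<inter> e = {u} \<and> g \<inter> f = {w})"

text \<open>The properties of a minimal uncolourable family that are used to find cycles, under the assumption
  that there is no dense list.\<close>

locale partnered =
  fixes H :: "'a set set"
  assumes finite_H: "finite H"
    and card_ge_3: "e \<in> H \<Longrightarrow> 3 \<le> card e"
    and partner: "e \<in> H \<Longrightarrow> v \<in> e \<Longrightarrow> \<exists>f\<in>H. f \<inter> e = {v}"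
    and no_dense: "dense_lists H = {}"
begin

lemma finite_edge: "e \<in> H \<Longrightarrow> finite e"
  using card_ge_3[of e] by (intro card_ge_0_finite) auto

lemma not_subset_small:
  assumes "f \<in> H" "f \<inter> U \<subseteq> {u, w}"
  shows "\<not> f \<subseteq> U"
proof
  assume "f \<subseteq> U"
  then have "f \<subseteq> {u, w}" using assms(2) by blast
  then have "card f \<le> card {u, w}" by (intro card_mono) auto
  also have "\<dots> \<le> 2" by (simp add: card_insert_if)
  finally show False using card_ge_3[OF assms(1)] by simp
qed

lemma no_attach_cycle: "es \<notin> attach H ((\<le>) 2) (loose_cycles H)"
  using no_dense unfolding dense_lists_def by blast

lemma no_attach_handle:
  "es \<notin> attach H ((\<le>) 2) (loose_ext H (attach H ((=) 1) (loose_cycles H)))"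
  using no_dense unfolding dense_lists_def by blast

text \<open>This rules out the first kind of dense list: \<open>f\<close> overlaps the path in two or more vertices, and
  \<open>g\<close> connects a vertex of the path with a vertex of \<open>f\<close> outside it.\<close>

lemma no_dense_ear:
  assumes P: "simple_path P" "P \<noteq> []" "set P \<subseteq> H" and f: "f \<in> H"
    and c: "2 \<le> card (f \<inter> \<Union>(set P))" "x \<in> f" "x \<notin> \<Union>(set P)"
    and g: "g \<in> H" "g \<inter> (f \<union> \<Union>(set P)) = {u, x}" "u \<noteq> x"
  shows False
proof -
  have "f # P \<in> attach H ((\<le>) 2) (loose_paths H)"
    using simple_path_loose_paths[OF P] f c unfolding attach_def by auto
  moreover have "\<not> g \<subseteq> f \<union> \<Union>(set P)"
    using not_subset_small[OF g(1), of "f \<union> \<Union>(set P)" u x] g(2) by simp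
  ultimately have "g # f # P \<in> attach H ((=) 2) (attach H ((\<le>) 2) (loose_paths H))"
    using g unfolding attach_def[of H "(=) 2"] by (auto simp: card_insert_if)
  then show False using no_dense unfolding dense_lists_def by blast
qed

lemma loose_cycle_in:
  assumes "loose_cycle e ys f g" "{e, f, g} \<union> set ys \<subseteq> H"
  shows "g # e # ys @ [f] \<in> loose_cycles H"
proof -
  from assms obtain u w where *: "simple_path (e # ys @ [f])" "g \<inter> \<Union>(set ys) = {}"
    "u \<noteq> w" "g \<inter> e = {u}" "g \<inter> f = {w}" unfolding loose_cycle_def by blast
  have eq: "g \<inter> \<Union>(set (e # ys @ [f])) = {u, w}" using * by auto
  have "\<not> g \<subseteq> \<Union>(set (e # ys @ [f]))"
    using assms(2) eq by (intro not_subset_small[of g _ u w]) auto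
  moreover have "card (g \<inter> \<Union>(set (e # ys @ [f]))) = 2" unfolding eq using *(3) by simp
  moreover have "e # ys @ [f] \<in> loose_paths H"
    using simple_path_loose_paths[OF *(1)] assms(2) by auto
  moreover have "g \<in> H" using assms(2) by simp
  ultimately show ?thesis unfolding loose_cycles_def attach_def
    by (intro CollectI exI[of _ g] exI[of _ "e # ys @ [f]"]) simp
qed

text \<open>Cut the path at the first edge that \<open>G\<close> meets. If \<open>G\<close> has only one vertex on that edge, the part up to there
  is a cycle closed by \<open>G\<close>. If it has more, list the edges in another order: \<open>e\<close> comes last
  and has exactly two vertices on the others, one on its neighbour and one on \<open>G\<close>. This is a dense list.\<close>

lemma hook:
  assumes sp: "simple_path (e # ps)" "ps \<noteq> []" "set (e # ps) \<subseteq> H"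
    and G: "G \<in> H" "G \<inter> e = {x}" "x \<notin> \<Union>(set ps)" "G \<inter> \<Union>(set ps) \<noteq> {}"
  shows "\<exists>ys f zs. ps = ys @ f # zs \<and> loose_cycle e ys f G"
proof -
  have "\<exists>p\<in>set ps. G \<inter> p \<noteq> {}" using G(4) by blast
  from split_list_first_prop[OF this] obtain ys f zs where ps: "ps = ys @ f # zs" "G \<inter> f \<noteq> {}" "\<forall>y\<in>set ys. \<not> G \<inter> y \<noteq> {}"
    by (elim exE conjE)
  have ys: "G \<inter> \<Union>(set ys) = {}" using ps(3) by auto
  have sp1: "simple_path (e # ys @ [f])"
    using sp(1) ps(1) simple_path_append1[of "e # ys @ [f]" zs] by simp
  then obtain v where v: "v \<in> hd (ys @ [f])" "e \<inter> \<Union>(set (ys @ [f])) = {v}"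
    by (rule simple_path_hd) simp
  have xf: "x \<notin> f" using G(3) ps(1) by auto
  show ?thesis
  proof (cases "2 \<le> card (G \<inter> f)")
    case True
    have "e \<inter> (G \<union> \<Union>(set (ys @ [f]))) = {v, x}" using v(2) G(2) by blast
    moreover have "G \<inter> \<Union>(set (ys @ [f])) = G \<inter> f" using ys by auto
    moreover have "simple_path (ys @ [f])" using sp1 simple_path_tl by blast
    moreover have "v \<noteq> x" "x \<in> G" "x \<notin> \<Union>(set (ys @ [f]))" "e \<in> H" "set (ys @ [f]) \<subseteq> H"
      using v(2) G(2,3) ps(1) sp(3) by auto
    ultimately have False using no_dense_ear[of "ys @ [f]" G x e v] G(1) True by auto
    then show ?thesis ..
  next
    case False
    have "finite (G \<inter> f)" using finite_edge[OF G(1)] by blast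
    then have "card (G \<inter> f) \<noteq> 0" using ps(2) by simp
    with False have "card (G \<inter> f) = 1" by linarith
    then obtain w where "G \<inter> f = {w}" by (auto simp: card_1_singleton_iff)
    then have "loose_cycle e ys f G"
      unfolding loose_cycle_def using sp1 ys G(2) xf by blast
    then show ?thesis using ps(1) by blast
  qed
qed

text \<open>Extend \<open>P0\<close> as far as possible. The last edge \<open>F\<close> has a vertex \<open>x\<close> on no other edge, and a partner of \<open>F\<close>
  at \<open>x\<close> that did not return to the path would extend it further.\<close>

lemma maximal_end:
  assumes "simple_path (P0 @ T)" "P0 \<noteq> []" "set P0 \<subseteq> H" "\<And>e. e \<in> set T \<Longrightarrow> 2 \<le> card e"
  obtains F ps x G where "simple_path (F # ps @ T)" "set (F # ps) \<subseteq> H" "x \<in> F"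
    "x \<notin> \<Union>(set (ps @ T))" "G \<in> H" "G \<inter> F = {x}" "G \<inter> \<Union>(set (ps @ T)) \<noteq> {}"
proof -
  let ?Q = "\<lambda>P. simple_path (P @ T) \<and> P \<noteq> [] \<and> set P \<subseteq> H"
  have "\<forall>P. ?Q P \<longrightarrow> length P < Suc (card H)"
  proof (intro allI impI)
    fix P assume P: "?Q P"
    then have "distinct (P @ T)"
      using assms(4) card_ge_3 by (intro simple_path_distinct) fastforce+
    then have "length P = card (set P)" by (simp add: distinct_card)
    also have "\<dots> \<le> card H" using P finite_H by (intro card_mono) auto
    finally show "length P < Suc (card H)" by simp
  qed
  then have "\<exists>P. ?Q P \<and> (\<forall>P'. ?Q P' \<longrightarrow> length P' \<le> length P)"
    using assms by (intro ex_has_greatest_nat[of ?Q P0]) auto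
  then obtain P where P: "?Q P" "\<And>P'. ?Q P' \<Longrightarrow> length P' \<le> length P" by blast
  then obtain F ps where Fps: "P = F # ps" by (cases P) auto
  have FH: "F \<in> H" using P Fps by simp
  have "\<exists>v. F \<inter> \<Union>(set (ps @ T)) \<subseteq> {v}"
  proof (cases "ps @ T = []")
    case False
    then show ?thesis using simple_path_hd[of F "ps @ T"] P Fps by (metis append_Cons subset_refl)
  qed auto
  then obtain v where "F \<inter> \<Union>(set (ps @ T)) \<subseteq> {v, v}" by auto
  then have "\<not> F \<subseteq> \<Union>(set (ps @ T))" by (rule not_subset_small[OF FH])
  then obtain x where x: "x \<in> F" "x \<notin> \<Union>(set (ps @ T))" by blast
  from partner[OF FH x(1)] obtain G where G: "G \<in> H" "G \<inter> F = {x}" by blast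
  have "G \<inter> \<Union>(set (ps @ T)) \<noteq> {}"
  proof
    assume "G \<inter> \<Union>(set (ps @ T)) = {}"
    then have "?Q (G # P)" using P(1) G Fps by (auto simp: is_singleton_def)
    then show False using P(2)[of "G # P"] by simp
  qed
  moreover have "simple_path (F # ps @ T)" "set (F # ps) \<subseteq> H" using P(1) Fps by auto
  ultimately show ?thesis using x G by (intro that)
qed

lemma ex_loose_cycle:
  assumes "H \<noteq> {}"
  shows "\<exists>e ys f g. loose_cycle e ys f g \<and> {e, f, g} \<union> set ys \<subseteq> H"
proof -
  obtain e where "e \<in> H" using assms by blast
  then have "simple_path ([e] @ [])" "[e] \<noteq> []" "set [e] \<subseteq> H" by auto
  then obtain F ps x G where "simple_path (F # ps @ [])" "set (F # ps) \<subseteq> H" "x \<in> F"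
    "x \<notin> \<Union>(set (ps @ []))" "G \<in> H" "G \<inter> F = {x}" "G \<inter> \<Union>(set (ps @ [])) \<noteq> {}"
    by (rule maximal_end) simp
  then have *: "simple_path (F # ps)" "set (F # ps) \<subseteq> H" "x \<in> F"
    "x \<notin> \<Union>(set ps)" "G \<in> H" "G \<inter> F = {x}" "G \<inter> \<Union>(set ps) \<noteq> {}"
    by simp_all
  then have "ps \<noteq> []" by auto
  from hook[OF *(1) this *(2,5,6,4,7)] obtain ys f zs where
    cyc: "ps = ys @ f # zs" "loose_cycle F ys f G" by (elim exE conjE)
  have "{F, f, G} \<union> set ys \<subseteq> H" using *(2,5) cyc(1) by simp
  with cyc(2) show ?thesis by (intro exI conjI)
qed

text \<open>An edge that is not contained in the cycle can meet it in one vertex only. Take a maximal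
  path that leaves the cycle there; the partner \<open>G\<close> at its end returns. Either \<open>G\<close> brings a
  new vertex and is the second overlap, or it does not; in the latter case drop the last edge of the path, which
  makes the vertex \<open>x\<close> new for \<open>G\<close>, while its other vertices, at least two, are old.\<close>

lemma loose_cycle_closed:
  assumes cyc: "loose_cycle e ys f g" "{e, f, g} \<union> set ys \<subseteq> H"
    and V: "V = \<Union>({e, f, g} \<union> set ys)"
    and F: "F \<in> H" "F \<inter> V \<noteq> {}"
  shows "F \<subseteq> V"
proof (rule ccontr)
  assume nF: "\<not> F \<subseteq> V"
  \<comment> \<open>The closing edge was added last.\<close>
  define c where "c = g # e # ys @ [f]"
  have c: "c \<in> loose_cycles H" unfolding c_def using loose_cycle_in[OF cyc] .
  have Vc: "\<Union>(set c) = V" by (auto simp: c_def V)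
  have finV: "finite V" unfolding V using cyc(2) finite_edge by blast
  have "\<not> 2 \<le> card (F \<inter> V)"
  proof
    assume "2 \<le> card (F \<inter> V)"
    then have "F # c \<in> attach H ((\<le>) 2) (loose_cycles H)"
      using c F nF unfolding attach_def by (auto simp: Vc)
    then show False using no_attach_cycle by blast
  qed
  moreover have "card (F \<inter> V) \<noteq> 0" using F(2) finV by simp
  ultimately have "card (F \<inter> V) = 1" by linarith
  then have sing: "is_singleton (F \<inter> V)" by (simp add: is_singleton_altdef)
  have cardV: "2 \<le> card V"
  proof -
    have "card e \<le> card V" using finV by (intro card_mono) (auto simp: V)
    then show ?thesis using card_ge_3[of e] cyc(2) by simp
  qed
  have "simple_path ([F] @ [V])" "[F] \<noteq> []" "set [F] \<subseteq> H" using sing F by auto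
  then obtain F' ps x G where *: "simple_path (F' # ps @ [V])" "set (F' # ps) \<subseteq> H" "x \<in> F'"
    "x \<notin> \<Union>(set (ps @ [V]))" "G \<in> H" "G \<inter> F' = {x}" "G \<inter> \<Union>(set (ps @ [V])) \<noteq> {}"
    by (rule maximal_end) (use cardV in simp)
  define W where "W = \<Union>(set (ps @ [V]))"
  have W: "\<Union>(set (ps @ c)) = W" by (auto simp: W_def Vc[symmetric])
  have G3: "3 \<le> card G" and finG: "finite G" using card_ge_3[OF *(5)] finite_edge[OF *(5)] by auto
  have xG: "x \<in> G" "x \<notin> W" using *(4,6) by (auto simp: W_def)
  have ext: "fs @ c \<in> loose_ext H (attach H ((=) 1) (loose_cycles H))"
    if "simple_path (fs @ [V])" "fs \<noteq> []" "set fs \<subseteq> H" for fs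
    by (rule simple_path_loose_ext[OF that c Vc]) (use card_ge_3 in fastforce)
  \<comment> \<open>\<open>W\<close> consists of the cycle and the path without its last edge \<open>F'\<close>.\<close>
  show False
  proof (cases "G \<subseteq> W \<union> F'")
    case False
    obtain w where w: "w \<in> G" "w \<in> W" using *(7) by (auto simp: W_def)
    have "{x, w} \<subseteq> G \<inter> (F' \<union> W)" using w xG *(3) by blast
    then have "card {x, w} \<le> card (G \<inter> (F' \<union> W))" using finG by (intro card_mono) auto
    moreover have "x \<noteq> w" using w xG by blast
    ultimately have "2 \<le> card (G \<inter> (F' \<union> W))" by simp
    then have "G # (F' # ps) @ c \<in> attach H ((\<le>) 2) (loose_ext H (attach H ((=) 1) (loose_cycles H)))"
      using ext[of "F' # ps"] * False W unfolding attach_def by (auto simp: Un_commute)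
    then show False using no_attach_handle by blast
  next
    case True
    then have eq: "G \<inter> W = G - {x}" using *(6) xG by blast
    have c2: "2 \<le> card (G \<inter> W)" unfolding eq using G3 xG finG by simp
    have nG: "\<not> G \<subseteq> W" using xG by blast
    show False
    proof (cases "ps = []")
      case True
      then have "W = V" by (auto simp: W_def)
      then have "G # c \<in> attach H ((\<le>) 2) (loose_cycles H)"
        using c c2 nG *(5) unfolding attach_def by (auto simp: Vc)
      then show False using no_attach_cycle by blast
    next
      case False
      then have "ps @ c \<in> loose_ext H (attach H ((=) 1) (loose_cycles H))"
        using ext[of ps] * simple_path_tl[of F' "ps @ [V]"] by simp
      then have "G # ps @ c \<in> attach H ((\<le>) 2) (loose_ext H (attach H ((=) 1) (loose_cycles H)))"
        using c2 nG *(5) unfolding attach_def W[symmetric] by blast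
      then show False using no_attach_handle by blast
    qed
  qed
qed

end


section \<open>Dense lists in a set system without proper colouring\<close>

context partnered
begin

text \<open>Let \<open>e, ys, f\<close> and \<open>g\<close> be a shortest loose cycle, \<open>y\<close> a vertex of \<open>g\<close> outside the path, and \<open>G\<close> a
  partner of \<open>g\<close> at \<open>y\<close>. Then \<open>G\<close> lies on the cycle and closes a cycle with \<open>g\<close> in
  both directions. As these are not shorter than the first one, that one is a triangle, and \<open>G\<close> has exactly one vertex on each of its edges. By symmetry
  each of the four edges is contained in the union of the others, which forces three vertices on each. The
  relation \<open>R\<close> is carried along to remember that \<open>g\<close> and \<open>G\<close> belong to different systems.\<close>

lemma ex_quadrilateral:
  assumes ne: "H \<noteq> {}"
    and R: "\<And>e v. e \<in> H \<Longrightarrow> v \<in> e \<Longrightarrow> \<exists>f\<in>H. R e f \<and> f \<inter> e = {v}"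
  obtains w a b y z t where "distinct [w, a, b, y, z, t]"
    "{w, a, z} \<in> H" "{w, b, t} \<in> H" "{a, b, y} \<in> H" "{y, z, t} \<in> H" "R {a, b, y} {y, z, t}"
proof -
  let ?Q = "\<lambda>n. \<exists>e ys f g. loose_cycle e ys f g \<and> {e, f, g} \<union> set ys \<subseteq> H \<and> length ys = n"
  define n where "n = (LEAST n. ?Q n)"
  have "\<exists>n. ?Q n" using ex_loose_cycle[OF ne] by (elim exE conjE) (intro exI conjI, auto)
  then have "?Q n" unfolding n_def by (rule LeastI_ex)
  then obtain e ys f g where cyc: "loose_cycle e ys f g" and sub: "{e, f, g} \<union> set ys \<subseteq> H"
    and n: "length ys = n" by blast
  have minimal: "length ys \<le> length ys'" if "loose_cycle e' ys' f' g'" "{e', f', g'} \<union> set ys' \<subseteq> H"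
    for e' ys' f' g'
    unfolding n unfolding n_def using that by (intro Least_le) blast
  from sub have mem: "e \<in> H" "f \<in> H" "g \<in> H" "set ys \<subseteq> H" by auto
  from cyc obtain a b where sp: "simple_path (e # ys @ [f])" and ab: "a \<noteq> b" "g \<inter> e = {a}" "g \<inter> f = {b}"
    and gys: "g \<inter> \<Union>(set ys) = {}" unfolding loose_cycle_def by blast
  have "g \<inter> \<Union>(set (e # ys @ [f])) \<subseteq> {a, b}" using ab gys by auto
  from not_subset_small[OF mem(3) this] obtain y
    where y: "y \<in> g" "y \<notin> e" "y \<notin> f" "y \<notin> \<Union>(set ys)" by auto
  from R[OF mem(3) y(1)] obtain G where G: "G \<in> H" "R g G" "G \<inter> g = {y}" by blast
  define V where "V = \<Union>({e, f, g} \<union> set ys)"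
  have "G \<inter> V \<noteq> {}" using G(3) by (auto simp: V_def)
  then have GV: "G \<subseteq> V" by (rule loose_cycle_closed[OF cyc sub V_def G(1)])
  \<comment> \<open>Otherwise all vertices of \<open>G\<close> but \<open>y\<close> are on \<open>f\<close>, and \<open>g\<close> connects the two.\<close>
  have "G \<inter> \<Union>(set (e # ys)) \<noteq> {}"
  proof
    assume "G \<inter> \<Union>(set (e # ys)) = {}"
    then have "G \<inter> e = {}" "G \<inter> \<Union>(set ys) = {}" by auto
    moreover have "G \<subseteq> e \<union> f \<union> g \<union> \<Union>(set ys)" using GV by (auto simp: V_def)
    ultimately have "G \<subseteq> (G \<inter> g) \<union> (G \<inter> f)" by blast
    then have "G \<subseteq> insert y (G \<inter> f)" unfolding G(3) by simp
    then have "card G \<le> card (insert y (G \<inter> f))"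
      using finite_edge[OF mem(2)] by (intro card_mono) auto
    also have "\<dots> \<le> Suc (card (G \<inter> f))" by (rule card_insert_le_m1) auto
    finally have "2 \<le> card (G \<inter> f)" using card_ge_3[OF G(1)] by simp
    moreover have "g \<inter> (G \<union> f) = {b, y}" using G(3) ab(3) by blast
    moreover have "b \<noteq> y" "y \<in> G" using y ab G(3) by auto
    ultimately show False
      using no_dense_ear[of "[f]" G y g b] mem G(1) y(3) by simp
  qed
  moreover have "simple_path (g # e # ys)"
    using simple_path_append1[of "e # ys" "[f]"] sp ab(2) gys by (simp add: is_singleton_def)
  moreover have "y \<notin> \<Union>(set (e # ys))" using y by simp
  ultimately obtain ys' f' zs where h: "e # ys = ys' @ f' # zs" "loose_cycle g ys' f' G"
    using hook[of g "e # ys" G y] mem G by auto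
  have set_ys': "set ys' \<union> {f'} \<union> set zs = set (e # ys)" using h(1) by auto
  then have "{g, f', G} \<union> set ys' \<subseteq> H" using mem G(1) by auto
  then have le: "length ys \<le> length ys'" using minimal[OF h(2)] by simp
  moreover have "Suc (length ys) = length ys' + Suc (length zs)" using arg_cong[OF h(1), of length] by simp
  ultimately have zs: "zs = []" by simp
  from h(2) obtain y' z where "y' \<noteq> z" "G \<inter> g = {y'}" and z: "G \<inter> f' = {z}" "G \<inter> \<Union>(set ys') = {}"
    unfolding loose_cycle_def by blast
  with G(3) have zy: "z \<noteq> y" by simp
  have "G \<inter> f \<noteq> {}"
  proof
    assume "G \<inter> f = {}"
    moreover have "V = f \<union> g \<union> \<Union>(set (e # ys))" by (auto simp: V_def)
    ultimately have "G \<inter> V \<subseteq> {y, z}"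
      using z G(3) unfolding set_ys'[symmetric] zs by auto
    then show False using GV not_subset_small[OF G(1)] by blast
  qed
  \<comment> \<open>In the other direction, \<open>f\<close> is the first edge that \<open>G\<close> meets, and the cycle has length three.\<close>
  then obtain ys2 f2 zs2 where h2: "[f] = ys2 @ f2 # zs2" "loose_cycle g ys2 f2 G"
    using hook[of g "[f]" G y] mem G ab y by (auto simp: is_singleton_def)
  then have f2: "ys2 = []" "f2 = f" by (auto simp: Cons_eq_append_conv)
  then have ys: "ys = []" using minimal[OF h2(2)] mem G by auto
  then have f': "f' = e" "ys' = []" using h(1) zs by (auto simp: Cons_eq_append_conv)
  from h2(2) f2 G(3) obtain t where t: "G \<inter> f = {t}" unfolding loose_cycle_def by auto
  have Ge: "G \<inter> e = {z}" using z f' by simp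
  have V: "V = e \<union> f \<union> g" using ys by (auto simp: V_def)
  have Gsub: "G \<subseteq> {y, z, t}" using GV G(3) t Ge V by blast
  have zt: "z \<noteq> t" using not_subset_small[OF G(1), of "{y, z, t}" y z] Gsub by auto
  have Geq: "G = {y, z, t}" using Gsub G(3) t Ge by blast
  from sp ys obtain w where w: "e \<inter> f = {w}" by (auto simp: is_singleton_def)
  have yt: "y \<noteq> t" and yz: "y \<noteq> z" using y t zy by auto
  have "loose_cycle e [] f G" unfolding loose_cycle_def using w Ge t zt by (simp add: is_singleton_def)
  then have "g \<subseteq> \<Union>({e, f, G} \<union> set [])"
    using mem G ab by (intro loose_cycle_closed[of e "[]" f G, OF _ _ refl]) auto
  then have "g \<subseteq> (g \<inter> e) \<union> (g \<inter> f) \<union> (G \<inter> g)" by auto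
  then have "g \<subseteq> {a, b, y}" unfolding ab G(3) by auto
  then have geq: "g = {a, b, y}" using ab y by blast
  have "f \<inter> g = {b}" using ab(3) by blast
  then have "loose_cycle f [] g G" unfolding loose_cycle_def
    using G(3) t yt by (auto simp: is_singleton_def)
  then have "e \<subseteq> \<Union>({f, g, G} \<union> set [])"
    using mem G ab by (intro loose_cycle_closed[of f "[]" g G, OF _ _ refl]) auto
  then have "e \<subseteq> (e \<inter> f) \<union> (g \<inter> e) \<union> (G \<inter> e)" by auto
  then have "e \<subseteq> {w, a, z}" unfolding ab w Ge by auto
  then have eeq: "e = {w, a, z}" using ab w Ge by blast
  have "e \<inter> g = {a}" using ab(2) by blast
  then have "loose_cycle e [] g G" unfolding loose_cycle_def
    using G(3) Ge yz by (auto simp: is_singleton_def)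
  then have "f \<subseteq> \<Union>({e, g, G} \<union> set [])"
    using mem G ab by (intro loose_cycle_closed[of e "[]" g G, OF _ _ refl]) auto
  then have "f \<subseteq> (e \<inter> f) \<union> (g \<inter> f) \<union> (G \<inter> f)" by auto
  then have "f \<subseteq> {w, b, t}" unfolding ab w t by auto
  then have feq: "f = {w, b, t}" using ab w t by blast
  have mem1: "a \<in> e" "a \<in> g" "b \<in> f" "b \<in> g" "w \<in> e" "w \<in> f" "z \<in> e" "z \<in> G" "t \<in> f" "t \<in> G"
    using eeq feq geq Geq by simp_all
  have "a \<notin> f" "b \<notin> e" using ab(1) mem1 ab(2)[THEN equalityD1] ab(3)[THEN equalityD1] by auto
  moreover from this have "w \<noteq> a" "w \<noteq> b" using mem1 by auto
  moreover have "z \<notin> f" "t \<notin> e" using zt mem1 Ge[THEN equalityD1] t[THEN equalityD1] by auto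
  moreover from this have "w \<noteq> z" "w \<noteq> t" "b \<noteq> z" "a \<noteq> t" using mem1 by auto
  moreover have "z \<notin> g" "t \<notin> g" using zy yt mem1 G(3)[THEN equalityD1] by auto
  moreover from this have "a \<noteq> z" "b \<noteq> t" using mem1 by auto
  moreover have "y \<noteq> a" "y \<noteq> b" "y \<noteq> w" using y(2,3) mem1 by auto
  ultimately have "distinct [w, a, b, y, z, t]" using zt yt yz ab(1) by simp
  then show ?thesis using mem G eeq feq geq Geq by (intro that[of w a b y z t]) auto
qed

text \<open>If \<open>F\<close> contained \<open>i\<close> and \<open>j\<close> but not \<open>c\<close>, its third point would be one of \<open>p\<close>, \<open>q\<close> and \<open>r\<close>. Then \<open>F\<close>
  overlaps the line through \<open>i\<close> and \<open>j\<close> in two points, and a line through the third point meets both: a dense list.\<close>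

lemma no_two_on_line:
  assumes dist: "distinct [i, j, c, p, q, r]"
    and lines: "{i, j, c} \<in> H" "{i, p, q} \<in> H" "{j, p, r} \<in> H"
    and F: "F \<in> H" "F \<subseteq> {i, j, c, p, q, r}" "card F = 3" "i \<in> F" "j \<in> F"
  shows "c \<in> F"
proof (rule ccontr)
  assume c: "c \<notin> F"
  have finF: "finite F" using finite_edge[OF F(1)] .
  have "card (F - {i, j}) = 1" using F finF dist by (simp add: card_Diff_subset)
  then obtain x where x: "F - {i, j} = {x}" by (auto simp: card_1_singleton_iff)
  then have Feq: "F = {i, j, x}" using F by blast
  have xpqr: "x \<in> {p, q, r}" "x \<noteq> i" "x \<noteq> j" "x \<noteq> c" using x F(2) c by blast+
  have eq: "F \<inter> \<Union>(set [{i, j, c}]) = {i, j}" using Feq xpqr by auto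
  have c2: "2 \<le> card (F \<inter> \<Union>(set [{i, j, c}]))" unfolding eq using dist by simp
  have xn: "x \<in> F" "x \<notin> \<Union>(set [{i, j, c}])" using Feq xpqr by auto
  have "x \<in> {p, q} \<or> x = r" using xpqr by blast
  then show False
  proof
    assume "x \<in> {p, q}"
    then have "{i, p, q} \<inter> (F \<union> \<Union>(set [{i, j, c}])) = {i, x}" using Feq dist by auto
    then show False using no_dense_ear[of "[{i, j, c}]" F x "{i, p, q}" i] lines F(1) c2 xn xpqr by simp
  next
    assume "x = r"
    then have "{j, p, r} \<inter> (F \<union> \<Union>(set [{i, j, c}])) = {j, x}" using Feq dist by auto
    then show False using no_dense_ear[of "[{i, j, c}]" F x "{j, p, r}" j] lines F(1) c2 xn xpqr by simp
  qed
qed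

text \<open>Any two of the six points that are not opposite to each other are on a line, and then \<open>F\<close> contains this line by
  \<open>no_two_on_line\<close>. Three points are never pairwise opposite.\<close>

lemma quadrilateral_only_lines:
  assumes dist: "distinct [w, a, b, y, z, t]"
    and lines: "{w, a, z} \<in> H" "{w, b, t} \<in> H" "{a, b, y} \<in> H" "{y, z, t} \<in> H"
    and F: "F \<in> H" "F \<subseteq> {w, a, b, y, z, t}" "card F = 3"
  shows "F \<in> {{w, a, z}, {w, b, t}, {a, b, y}, {y, z, t}}"
proof -
  have p1: "z \<in> F" if "w \<in> F" "a \<in> F"
    by (rule no_two_on_line[OF _ _ _ _ F(1) _ F(3) that, of z b t y])
      (use dist lines F(2) in \<open>auto simp: insert_commute\<close>)
  have p2: "a \<in> F" if "w \<in> F" "z \<in> F"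
    by (rule no_two_on_line[OF _ _ _ _ F(1) _ F(3) that, of a t b y])
      (use dist lines F(2) in \<open>auto simp: insert_commute\<close>)
  have p3: "w \<in> F" if "a \<in> F" "z \<in> F"
    by (rule no_two_on_line[OF _ _ _ _ F(1) _ F(3) that, of w y b t])
      (use dist lines F(2) in \<open>auto simp: insert_commute\<close>)
  have p4: "t \<in> F" if "w \<in> F" "b \<in> F"
    by (rule no_two_on_line[OF _ _ _ _ F(1) _ F(3) that, of t a z y])
      (use dist lines F(2) in \<open>auto simp: insert_commute\<close>)
  have p5: "b \<in> F" if "w \<in> F" "t \<in> F"
    by (rule no_two_on_line[OF _ _ _ _ F(1) _ F(3) that, of b z a y])
      (use dist lines F(2) in \<open>auto simp: insert_commute\<close>)
  have p6: "w \<in> F" if "b \<in> F" "t \<in> F"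
    by (rule no_two_on_line[OF _ _ _ _ F(1) _ F(3) that, of w y a z])
      (use dist lines F(2) in \<open>auto simp: insert_commute\<close>)
  have p7: "y \<in> F" if "a \<in> F" "b \<in> F"
    by (rule no_two_on_line[OF _ _ _ _ F(1) _ F(3) that, of y w z t])
      (use dist lines F(2) in \<open>auto simp: insert_commute\<close>)
  have p8: "b \<in> F" if "a \<in> F" "y \<in> F"
    by (rule no_two_on_line[OF _ _ _ _ F(1) _ F(3) that, of b z w t])
      (use dist lines F(2) in \<open>auto simp: insert_commute\<close>)
  have p9: "a \<in> F" if "b \<in> F" "y \<in> F"
    by (rule no_two_on_line[OF _ _ _ _ F(1) _ F(3) that, of a t w z])
      (use dist lines F(2) in \<open>auto simp: insert_commute\<close>)
  have p10: "t \<in> F" if "y \<in> F" "z \<in> F"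
    by (rule no_two_on_line[OF _ _ _ _ F(1) _ F(3) that, of t a b w])
      (use dist lines F(2) in \<open>auto simp: insert_commute\<close>)
  have p11: "z \<in> F" if "y \<in> F" "t \<in> F"
    by (rule no_two_on_line[OF _ _ _ _ F(1) _ F(3) that, of z b a w])
      (use dist lines F(2) in \<open>auto simp: insert_commute\<close>)
  have p12: "y \<in> F" if "z \<in> F" "t \<in> F"
    by (rule no_two_on_line[OF _ _ _ _ F(1) _ F(3) that, of y w a b])
      (use dist lines F(2) in \<open>auto simp: insert_commute\<close>)
  have full: "F = {i, j, k}" if "i \<in> F" "j \<in> F" "k \<in> F" "distinct [i, j, k]" for i j k
    using that F(3) finite_edge[OF F(1)] by (intro card_subset_eq[symmetric]) auto
  show ?thesis
  proof (rule ccontr)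
    assume nF: "\<not> ?thesis"
    have no: "\<not> (w \<in> F \<and> a \<in> F \<and> z \<in> F)" "\<not> (w \<in> F \<and> b \<in> F \<and> t \<in> F)"
      "\<not> (a \<in> F \<and> b \<in> F \<and> y \<in> F)" "\<not> (y \<in> F \<and> z \<in> F \<and> t \<in> F)"
      using full[of w a z] full[of w b t] full[of a b y] full[of y z t] nF dist by auto
    have *: "a \<notin> F" "z \<notin> F" "b \<notin> F" "t \<notin> F" if w: "w \<in> F"
      using p1[OF w] p2[OF w] p4[OF w] p5[OF w] no(1,2) w by iprover+
    have **: "a \<notin> F" "z \<notin> F" "b \<notin> F" "t \<notin> F" if y: "y \<in> F"
      using p8[OF _ y] p9[OF _ y] p10[OF y] p11[OF y] no(3,4) y by iprover+
    have ***: "b \<notin> F" "z \<notin> F" if "a \<in> F \<or> t \<in> F"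
    proof -
      show "b \<notin> F" using that p7 p6 no(2,3) by iprover
      show "z \<notin> F" using that p3 p12 no(1,4) by iprover
    qed
    have cover: "x = w \<or> x = a \<or> x = b \<or> x = y \<or> x = z \<or> x = t" if "x \<in> F" for x
      using subsetD[OF F(2) that] by simp
    consider "w \<in> F \<or> y \<in> F" | "w \<notin> F" "y \<notin> F" "a \<in> F \<or> t \<in> F"
      | "w \<notin> F" "y \<notin> F" "a \<notin> F" "t \<notin> F" by blast
    then have "F \<subseteq> {w, y} \<or> F \<subseteq> {a, t} \<or> F \<subseteq> {b, z}"
    proof cases
      case 1
      then have "a \<notin> F" "z \<notin> F" "b \<notin> F" "t \<notin> F" using * ** by iprover+
      then have "x \<in> {w, y}" if "x \<in> F" for x using cover[OF that] that by auto
      then show ?thesis by blast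
    next
      case 2
      then have "b \<notin> F" "z \<notin> F" using *** by iprover+
      then have "x \<in> {a, t}" if "x \<in> F" for x using cover[OF that] that 2(1,2) by auto
      then show ?thesis by blast
    next
      case 3
      then have "x \<in> {b, z}" if "x \<in> F" for x using cover[OF that] that by auto
      then show ?thesis by blast
    qed
    then obtain u v where "F \<subseteq> {u, v}" by blast
    then have "card F \<le> card {u, v}" by (intro card_mono) auto
    also have "\<dots> \<le> 2" by (simp add: card_insert_if)
    finally show False using F(3) by simp
  qed
qed

end

text \<open>Since \<open>{a', b', y}\<close> and \<open>{y, z, t}\<close> come from different systems, all edges of both systems have
  three vertices. By \<open>loose_cycle_closed\<close> and \<open>quadrilateral_only_lines\<close> the edges other than the four lines avoid
  the six points, so that a colouring of those extends: \<open>w\<close>, \<open>a'\<close> and \<open>t\<close> in one colour and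
  \<open>b'\<close>, \<open>y\<close> and \<open>z\<close> in the other leave no line monochromatic.\<close>

lemma critical_dense:
  assumes fin: "finite \<A>" "finite \<B>"
    and a: "\<And>e. e \<in> \<A> \<Longrightarrow> card e = a" "3 \<le> a"
    and b: "\<And>e. e \<in> \<B> \<Longrightarrow> card e = b" "3 \<le> b"
    and crit: "critical \<A> \<B>"
  shows "dense_lists (\<A> \<union> \<B>) \<noteq> {}"
proof
  assume nd: "dense_lists (\<A> \<union> \<B>) = {}"
  define opp where "opp e f \<longleftrightarrow> e \<in> \<A> \<and> f \<in> \<B> \<or> e \<in> \<B> \<and> f \<in> \<A>" for e f
  have R: "\<exists>f\<in>\<A> \<union> \<B>. opp e f \<and> f \<inter> e = {v}" if eH: "e \<in> \<A> \<union> \<B>" and ve: "v \<in> e" for e v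
  proof (cases "e \<in> \<A>")
    case True
    then obtain f where "f \<in> \<B>" "f \<inter> e = {v}" using critical_partner[OF crit _ ve] by blast
    then show ?thesis using True by (auto simp: opp_def)
  next
    case False
    then have "e \<in> \<B>" using eH by simp
    moreover have "critical \<B> \<A>" using crit critical_commute by blast
    ultimately obtain f where "f \<in> \<A>" "f \<inter> e = {v}" using critical_partner[of \<B> \<A> e v] ve by blast
    then show ?thesis using \<open>e \<in> \<B>\<close> by (auto simp: opp_def)
  qed
  interpret partnered "\<A> \<union> \<B>"
  proof
    show "finite (\<A> \<union> \<B>)" using fin by simp
    show "\<exists>f\<in>\<A> \<union> \<B>. f \<inter> e = {v}" if "e \<in> \<A> \<union> \<B>" "v \<in> e" for e v
      using R[OF that] by blast
    show "3 \<le> card e" if "e \<in> \<A> \<union> \<B>" for e using that a b by auto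
  qed (rule nd)
  have nc: "\<not> colourable \<A> \<B>" using crit by (simp add: critical_def)
  have "\<A> \<union> \<B> \<noteq> {}" using nc by (auto simp: colourable_def)
  from ex_quadrilateral[of opp, OF this R] obtain w a' b' y z t
    where dist: "distinct [w, a', b', y, z, t]"
    and L: "{w, a', z} \<in> \<A> \<union> \<B>" "{w, b', t} \<in> \<A> \<union> \<B>" "{a', b', y} \<in> \<A> \<union> \<B>" "{y, z, t} \<in> \<A> \<union> \<B>"
    and o: "opp {a', b', y} {y, z, t}" by blast
  have "card {a', b', y} = 3" "card {y, z, t} = 3" using dist by auto
  then have "a = 3" "b = 3" using o a(1) b(1) unfolding opp_def by metis+
  then have three: "card F = 3" if "F \<in> \<A> \<union> \<B>" for F using that a(1) b(1) by auto
  define V where "V = {w, a', b', y, z, t}"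
  have "loose_cycle {w, a', z} [] {w, b', t} {a', b', y}"
  proof -
    have "{w, a', z} \<inter> {w, b', t} = {w}" "{a', b', y} \<inter> {w, a', z} = {a'}"
      "{a', b', y} \<inter> {w, b', t} = {b'}" using dist by auto
    then show ?thesis unfolding loose_cycle_def using dist by (auto simp: is_singleton_def)
  qed
  then have closed: "F \<subseteq> V" if "F \<in> \<A> \<union> \<B>" "F \<inter> V \<noteq> {}" for F
    using L that by (intro loose_cycle_closed[of "{w, a', z}" "[]" "{w, b', t}" "{a', b', y}"])
      (auto simp: V_def)
  have lines: "F \<in> {{w, a', z}, {w, b', t}, {a', b', y}, {y, z, t}}"
    if "F \<in> \<A> \<union> \<B>" "F \<inter> V \<noteq> {}" for F
    using quadrilateral_only_lines[OF dist L that(1)] closed[OF that] three[OF that(1)]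
    by (simp add: V_def)
  obtain \<phi> where \<phi>: "\<forall>e\<in>\<A> - {{a', b', y}}. \<exists>v\<in>e. \<not> \<phi> v" "\<forall>e\<in>\<B> - {{a', b', y}}. \<exists>v\<in>e. \<phi> v"
  proof -
    from L(3) have "colourable (\<A> - {{a', b', y}}) \<B> \<or> colourable \<A> (\<B> - {{a', b', y}})"
      using crit by (auto simp: critical_def)
    then show ?thesis
    proof
      assume "colourable (\<A> - {{a', b', y}}) \<B>"
      then obtain \<phi> where "\<forall>e\<in>\<A> - {{a', b', y}}. \<exists>v\<in>e. \<not> \<phi> v" "\<forall>e\<in>\<B>. \<exists>v\<in>e. \<phi> v"
        unfolding colourable_def by (elim exE conjE)
      then show ?thesis by (intro that[of \<phi>]) auto
    next
      assume "colourable \<A> (\<B> - {{a', b', y}})"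
      then obtain \<phi> where "\<forall>e\<in>\<A>. \<exists>v\<in>e. \<not> \<phi> v" "\<forall>e\<in>\<B> - {{a', b', y}}. \<exists>v\<in>e. \<phi> v"
        unfolding colourable_def by (elim exE conjE)
      then show ?thesis by (intro that[of \<phi>]) auto
    qed
  qed
  define \<psi> where "\<psi> v = (if v \<in> V then v \<in> {w, a', t} else \<phi> v)" for v
  have inV: "(\<exists>v\<in>F. \<psi> v) \<and> (\<exists>v\<in>F. \<not> \<psi> v)" if "F \<in> \<A> \<union> \<B>" "F \<inter> V \<noteq> {}" for F
    using lines[OF that] dist by (auto simp: \<psi>_def V_def)
  have outV: "\<psi> v = \<phi> v" if "F \<inter> V = {}" "v \<in> F" for F v
    using that by (auto simp: \<psi>_def)
  have "\<exists>v\<in>F. \<not> \<psi> v" if "F \<in> \<A>" for F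
  proof (cases "F \<inter> V = {}")
    case True
    then have "F \<noteq> {a', b', y}" by (auto simp: V_def)
    then obtain v where "v \<in> F" "\<not> \<phi> v" using \<phi>(1) \<open>F \<in> \<A>\<close> by blast
    then show ?thesis using outV[OF True] by blast
  qed (use inV that in blast)
  moreover have "\<exists>v\<in>F. \<psi> v" if "F \<in> \<B>" for F
  proof (cases "F \<inter> V = {}")
    case True
    then have "F \<noteq> {a', b', y}" by (auto simp: V_def)
    then obtain v where "v \<in> F" "\<phi> v" using \<phi>(2) \<open>F \<in> \<B>\<close> by blast
    then show ?thesis using outV[OF True] by blast
  qed (use inV that in blast)
  ultimately have "colourable \<A> \<B>" unfolding colourable_def by (intro exI[of _ \<psi>]) simp
  then show False using nc by simp
qed

lemma not_colourable_dense:
  assumes "finite \<A>" "finite \<B>"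
    and "\<And>e. e \<in> \<A> \<Longrightarrow> card e = a" "3 \<le> a"
    and "\<And>e. e \<in> \<B> \<Longrightarrow> card e = b" "3 \<le> b"
    and "\<not> colourable \<A> \<B>"
  shows "dense_lists (\<A> \<union> \<B>) \<noteq> {}"
proof -
  obtain \<A>' \<B>' where *: "\<A>' \<subseteq> \<A>" "\<B>' \<subseteq> \<B>" "critical \<A>' \<B>'"
    using ex_critical assms by metis
  have "dense_lists (\<A>' \<union> \<B>') \<noteq> {}"
    using assms(3,5) *(1,2) finite_subset[OF *(1) assms(1)] finite_subset[OF *(2) assms(2)]
    by (intro critical_dense[OF _ _ _ assms(4) _ assms(6) *(3)]) auto
  moreover have "dense_lists (\<A>' \<union> \<B>') \<subseteq> dense_lists (\<A> \<union> \<B>)"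
    using * by (intro dense_lists_mono) auto
  ultimately show ?thesis by blast
qed


section \<open>The expected number of dense lists\<close>

text \<open>For \<open>c = 1\<close> and \<open>q = p\<close> this is the expected number of members of \<open>X\<close> whose edges are all contained in the random set. The
  factor for the head counts the vertices at which a loose extension can continue.\<close>

definition weight :: "('a set \<Rightarrow> real) \<Rightarrow> real \<Rightarrow> 'a set list set \<Rightarrow> real" where
  "weight c q X = (\<Sum>es\<in>X. c (hd es) * q ^ card (\<Union>(set es)))"

text \<open>The bounds are on the expected number of edges through prescribed vertices, weighted by their size in the case
  of a single vertex, as in \<open>weight\<close>. They are assumed at a probability \<open>Q\<close>
  larger than the one of interest because each unrestricted choice of a set of old vertices is paid for by
  doubling the probability: there are at most \<open>2 ^ m\<close> choices among \<open>m\<close> vertices.\<close>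

locale sparse_edges =
  fixes H :: "'a set set" and Q \<epsilon>\<^sub>2 \<epsilon>\<^sub>3 :: real
  assumes finite_H: "finite H"
    and card_ge_2: "e \<in> H \<Longrightarrow> 2 \<le> card e"
    and Q: "0 \<le> Q"
    and eps: "0 \<le> \<epsilon>\<^sub>2" "0 \<le> \<epsilon>\<^sub>3"
    and deg1: "(\<Sum>f\<in>{f\<in>H. {v} \<subset> f}. real (card f) * Q ^ (card f - 1)) \<le> 1 / 2"
    and deg2: "card S = 2 \<Longrightarrow> (\<Sum>f\<in>{f\<in>H. S \<subset> f}. Q ^ (card f - card S)) \<le> \<epsilon>\<^sub>2"
    and deg3: "2 \<le> card S \<Longrightarrow> (\<Sum>f\<in>{f\<in>H. S \<subset> f}. Q ^ (card f - card S)) \<le> \<epsilon>\<^sub>3"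
begin

definition "edge_lists X \<longleftrightarrow> (\<forall>es\<in>X. set es \<subseteq> H \<and> distinct es)"

lemma finite_edge: "e \<in> H \<Longrightarrow> finite e"
  using card_ge_2[of e] by (intro card_ge_0_finite) auto

lemma edge_lists_finite: "edge_lists X \<Longrightarrow> finite X"
  by (rule finite_subset[OF _ finite_subset_distinct[OF finite_H]]) (auto simp: edge_lists_def)

lemma edge_lists_finite_Union: "edge_lists X \<Longrightarrow> es \<in> X \<Longrightarrow> finite (\<Union>(set es))"
  unfolding edge_lists_def by (intro finite_Union) (auto intro: finite_edge)

lemma edge_lists_attach:
  assumes "edge_lists X"
  shows "edge_lists (attach H J X)"
  unfolding edge_lists_def
proof
  fix l assume "l \<in> attach H J X"
  then obtain f es where l: "l = f # es" "es \<in> X" "f \<in> H" "\<not> f \<subseteq> \<Union>(set es)"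
    unfolding attach_def by blast
  then have "f \<notin> set es" by blast
  then show "set l \<subseteq> H \<and> distinct l" using l assms by (simp add: edge_lists_def)
qed

lemma edge_lists_loose_ext:
  assumes "edge_lists X"
  shows "edge_lists (loose_ext H X)"
  unfolding edge_lists_def
proof
  fix es assume "es \<in> loose_ext H X"
  then show "set es \<subseteq> H \<and> distinct es"
  proof induction
    case (base es)
    then show ?case using assms by (auto simp: edge_lists_def)
  next
    case (step es f v)
    have "f \<notin> set es"
    proof
      assume "f \<in> set es"
      then have "f \<inter> \<Union>(set es) = f" by blast
      then have "f = {v}" using step.hyps(3) by simp
      then show False using card_ge_2[OF step.hyps(2)] by simp
    qed
    then show ?case using step by simp
  qed
qed

lemma edge_lists_paths: "edge_lists (loose_paths H)"
  unfolding loose_paths_def by (rule edge_lists_loose_ext) (auto simp: edge_lists_def)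

lemma edge_lists_cycles: "edge_lists (loose_cycles H)"
  unfolding loose_cycles_def by (rule edge_lists_attach[OF edge_lists_paths])

lemma weight_union:
  assumes "finite X" "finite Y" "0 \<le> q" "\<And>e. 0 \<le> c e"
  shows "weight c q (X \<union> Y) \<le> weight c q X + weight c q Y"
proof -
  have "weight c q (X \<union> Y) + weight c q (X \<inter> Y) = weight c q X + weight c q Y"
    unfolding weight_def using assms by (intro sum.union_inter)
  moreover have "0 \<le> weight c q (X \<inter> Y)"
    unfolding weight_def using assms by (intro sum_nonneg) simp
  ultimately show ?thesis by simp
qed

text \<open>Sort the new edges by their intersection with the old vertices, which is one of the sets in \<open>T\<close>.\<close>

lemma sum_by_trace:
  assumes U: "finite U" and A: "A \<subseteq> H" "\<And>f. f \<in> A \<Longrightarrow> f \<inter> U \<in> T \<and> \<not> f \<subseteq> U" and T: "finite T"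
    and q: "0 \<le> q" and c: "\<And>f. 0 \<le> c f"
    and deg: "\<And>S. S \<in> T \<Longrightarrow> (\<Sum>f\<in>{f\<in>H. S \<subset> f}. c f * q ^ (card f - card S)) \<le> \<epsilon>"
  shows "(\<Sum>f\<in>A. c f * q ^ card (f \<union> U)) \<le> real (card T) * \<epsilon> * q ^ card U"
proof -
  have finA: "finite A" using A(1) finite_H finite_subset by blast
  have card: "card (f \<union> U) = card U + (card f - card (f \<inter> U))" if "f \<in> A" for f
  proof -
    have "finite f" using that A(1) finite_edge by blast
    then show ?thesis using card_Un_Int[of f U] U card_mono[of f "f \<inter> U"] by simp
  qed
  have "(\<Sum>f\<in>A. c f * q ^ card (f \<union> U))
      = (\<Sum>f\<in>A. q ^ card U * (c f * q ^ (card f - card (f \<inter> U))))"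
    by (intro sum.cong refl) (simp add: card power_add)
  also have "\<dots> = q ^ card U * (\<Sum>f\<in>A. c f * q ^ (card f - card (f \<inter> U)))"
    by (simp add: sum_distrib_left)
  finally have 1: "(\<Sum>f\<in>A. c f * q ^ card (f \<union> U))
      = q ^ card U * (\<Sum>f\<in>A. c f * q ^ (card f - card (f \<inter> U)))" .
  have "(\<Sum>f\<in>A. c f * q ^ (card f - card (f \<inter> U)))
      = (\<Sum>S\<in>T. \<Sum>f\<in>{f\<in>A. f \<inter> U = S}. c f * q ^ (card f - card (f \<inter> U)))"
    using finA T A by (intro sum.group[symmetric]) auto
  also have "\<dots> \<le> (\<Sum>S\<in>T. \<epsilon>)"
  proof (rule sum_mono)
    fix S assume S: "S \<in> T"
    have "(\<Sum>f\<in>{f\<in>A. f \<inter> U = S}. c f * q ^ (card f - card (f \<inter> U)))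
        = (\<Sum>f\<in>{f\<in>A. f \<inter> U = S}. c f * q ^ (card f - card S))"
      by (intro sum.cong) auto
    also have "\<dots> \<le> (\<Sum>f\<in>{f\<in>H. S \<subset> f}. c f * q ^ (card f - card S))"
      using A finite_H q c by (intro sum_mono2) auto
    also have "\<dots> \<le> \<epsilon>" using deg[OF S] .
    finally show "(\<Sum>f\<in>{f\<in>A. f \<inter> U = S}. c f * q ^ (card f - card (f \<inter> U))) \<le> \<epsilon>" .
  qed
  finally have "(\<Sum>f\<in>A. c f * q ^ (card f - card (f \<inter> U))) \<le> real (card T) * \<epsilon>" by simp
  then have "q ^ card U * (\<Sum>f\<in>A. c f * q ^ (card f - card (f \<inter> U))) \<le> q ^ card U * (real (card T) * \<epsilon>)"
    using q by (intro mult_left_mono) auto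
  then show ?thesis unfolding 1 by (simp only: mult_ac)
qed

lemma weight_Cons:
  assumes "finite X" "\<And>es. finite (A es)"
  shows "weight c q {f # es |f es. es \<in> X \<and> f \<in> A es}
    = (\<Sum>es\<in>X. \<Sum>f\<in>A es. c f * q ^ card (f \<union> \<Union>(set es)))"
proof -
  have eq: "{f # es |f es. es \<in> X \<and> f \<in> A es} = (\<lambda>(es, f). f # es) ` Sigma X A"
    by (auto simp: image_iff)
  have "weight c q {f # es |f es. es \<in> X \<and> f \<in> A es}
      = (\<Sum>(es, f)\<in>Sigma X A. c f * q ^ card (f \<union> \<Union>(set es)))"
    unfolding weight_def eq by (subst sum.reindex) (auto simp: inj_on_def case_prod_unfold comp_def)
  also have "\<dots> = (\<Sum>es\<in>X. \<Sum>f\<in>A es. c f * q ^ card (f \<union> \<Union>(set es)))"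
    using assms by (intro sum.Sigma[symmetric]) auto
  finally show ?thesis .
qed

text \<open>The intersection of the new edge with the old vertices can be any set of old vertices, whence the factor 2.\<close>

lemma weight_attach:
  assumes X: "edge_lists X" and q: "0 \<le> q" and c: "\<And>f. 0 \<le> c f" and \<epsilon>: "0 \<le> \<epsilon>"
    and deg: "\<And>S. J (card S) \<Longrightarrow> (\<Sum>f\<in>{f\<in>H. S \<subset> f}. c f * q ^ (card f - card S)) \<le> \<epsilon>"
  shows "weight c q (attach H J X) \<le> \<epsilon> * weight (\<lambda>_. 1) (2 * q) X"
proof -
  let ?A = "\<lambda>es. {f \<in> H. J (card (f \<inter> \<Union>(set es))) \<and> \<not> f \<subseteq> \<Union>(set es)}"
  have "attach H J X = {f # es |f es. es \<in> X \<and> f \<in> ?A es}" by (auto simp: attach_def)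
  then have "weight c q (attach H J X)
      = (\<Sum>es\<in>X. \<Sum>f\<in>?A es. c f * q ^ card (f \<union> \<Union>(set es)))"
    using weight_Cons[of X ?A c q] edge_lists_finite[OF X] finite_H by simp
  also have "\<dots> \<le> (\<Sum>es\<in>X. \<epsilon> * (1 * (2 * q) ^ card (\<Union>(set es))))"
  proof (rule sum_mono)
    fix es assume "es \<in> X"
    then have U: "finite (\<Union>(set es))" using edge_lists_finite_Union[OF X] by blast
    let ?T = "{S \<in> Pow (\<Union>(set es)). J (card S)}"
    have T: "finite ?T" using U by simp
    have "card ?T \<le> card (Pow (\<Union>(set es)))" using U by (intro card_mono) auto
    then have cT: "real (card ?T) \<le> 2 ^ card (\<Union>(set es))" using U by (simp add: card_Pow)
    have "(\<Sum>f\<in>?A es. c f * q ^ card (f \<union> \<Union>(set es))) \<le> real (card ?T) * \<epsilon> * q ^ card (\<Union>(set es))"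
      using U T q c deg by (intro sum_by_trace) auto
    also have "\<dots> \<le> 2 ^ card (\<Union>(set es)) * \<epsilon> * q ^ card (\<Union>(set es))"
      using cT q \<epsilon> by (intro mult_right_mono) auto
    finally show "(\<Sum>f\<in>?A es. c f * q ^ card (f \<union> \<Union>(set es)))
      \<le> \<epsilon> * (1 * (2 * q) ^ card (\<Union>(set es)))"
      by (simp add: power_mult_distrib mult.assoc mult.left_commute)
  qed
  finally show ?thesis by (simp add: weight_def sum_distrib_left)
qed

lemma deg_mono:
  assumes "0 \<le> q" "q \<le> Q" "\<And>f. 0 \<le> c f" "(\<Sum>f\<in>{f\<in>H. S \<subset> f}. c f * Q ^ (card f - card S)) \<le> \<epsilon>"
  shows "(\<Sum>f\<in>{f\<in>H. S \<subset> f}. c f * q ^ (card f - card S)) \<le> \<epsilon>"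
  using assms by (intro order.trans[OF sum_mono assms(4)] mult_left_mono power_mono) auto

text \<open>Appending one edge loosely at most halves the total weight: the head has \<open>card (hd es)\<close> vertices at which
  the new edge can be attached, and by \<open>deg1\<close> each contributes at most one half, including the factor
  for the new head. As the set of all loose extensions consists of \<open>X\<close> and of loose extensions with one
  edge appended, summing over all lengths takes a single inequality instead of a geometric series.\<close>

lemma weight_loose_ext:
  assumes X: "edge_lists X" and q: "0 \<le> q" "q \<le> Q"
  shows "weight (\<lambda>e. real (card e)) q (loose_ext H X) \<le> 2 * weight (\<lambda>e. real (card e)) q X"
proof -
  define Z where "Z = loose_ext H X"
  have Z: "edge_lists Z" unfolding Z_def by (rule edge_lists_loose_ext[OF X])
  let ?c = "\<lambda>e::'a set. real (card e)"
  let ?A = "\<lambda>es. {f \<in> H. \<exists>v\<in>hd es. f \<inter> \<Union>(set es) = {v}}"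
  define Y where "Y = {f # es |f es. es \<in> Z \<and> f \<in> ?A es}"
  \<comment> \<open>\<open>Y\<close> consists of the members of \<open>Z\<close> with one more edge.\<close>
  have "Z \<subseteq> X \<union> Y"
  proof
    fix es assume "es \<in> Z"
    then have "es \<in> loose_ext H X" unfolding Z_def .
    then show "es \<in> X \<union> Y"
    proof cases
      case (step es' f v)
      then have "f \<in> ?A es'" "es' \<in> Z" unfolding Z_def by auto
      then show ?thesis using step(1) unfolding Y_def by blast
    qed simp
  qed
  moreover have "finite Y"
  proof -
    have "Y \<subseteq> (\<lambda>(f, es). f # es) ` (H \<times> Z)" unfolding Y_def by auto
    then show ?thesis
      by (rule finite_subset) (intro finite_imageI finite_cartesian_product finite_H edge_lists_finite[OF Z])
  qed
  ultimately have "weight ?c q Z \<le> weight ?c q (X \<union> Y)"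
    unfolding weight_def using edge_lists_finite[OF X] q by (intro sum_mono2) auto
  also have "\<dots> \<le> weight ?c q X + weight ?c q Y"
    using edge_lists_finite[OF X] \<open>finite Y\<close> q by (intro weight_union) auto
  also have "weight ?c q Y = (\<Sum>es\<in>Z. \<Sum>f\<in>?A es. ?c f * q ^ card (f \<union> \<Union>(set es)))"
    unfolding Y_def using edge_lists_finite[OF Z] finite_H by (intro weight_Cons) auto
  also have "\<dots> \<le> (\<Sum>es\<in>Z. 1 / 2 * (?c (hd es) * q ^ card (\<Union>(set es))))"
  proof (rule sum_mono)
    fix es assume es: "es \<in> Z"
    show "(\<Sum>f\<in>?A es. ?c f * q ^ card (f \<union> \<Union>(set es))) \<le> 1 / 2 * (?c (hd es) * q ^ card (\<Union>(set es)))"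
    proof (cases "es = []")
      case False
      have U: "finite (\<Union>(set es))" using edge_lists_finite_Union[OF Z es] .
      have "hd es \<in> H" using es Z False by (cases es) (auto simp: edge_lists_def)
      then have hd: "finite (hd es)" by (rule finite_edge)
      let ?T = "(\<lambda>v. {v}) ` hd es"
      have cT: "card ?T = card (hd es)" by (intro card_image) (auto simp: inj_on_def)
      have ns: "\<not> f \<subseteq> \<Union>(set es)" if "f \<in> H" "f \<inter> \<Union>(set es) = {v}" for f v
      proof
        assume "f \<subseteq> \<Union>(set es)"
        then have "f = {v}" using that(2) by blast
        then show False using card_ge_2[OF that(1)] by simp
      qed
      have "(\<Sum>f\<in>?A es. ?c f * q ^ card (f \<union> \<Union>(set es))) \<le> real (card ?T) * (1 / 2) * q ^ card (\<Union>(set es))"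
      proof (rule sum_by_trace[OF U])
        fix S assume "S \<in> ?T"
        then obtain v where "S = {v}" by blast
        then show "(\<Sum>f\<in>{f\<in>H. S \<subset> f}. ?c f * q ^ (card f - card S)) \<le> 1 / 2"
          using deg1[of v] by (intro deg_mono[OF q]) auto
      qed (use hd q ns in auto)
      then show ?thesis unfolding cT by (simp add: mult_ac)
    qed auto
  qed
  also have "\<dots> = 1 / 2 * weight ?c q Z" by (simp add: weight_def sum_distrib_left)
  finally show ?thesis unfolding Z_def by simp
qed

lemma weight_one_le:
  assumes "edge_lists X" "\<And>es. es \<in> X \<Longrightarrow> es \<noteq> []" "0 \<le> q"
  shows "weight (\<lambda>_. 1) q X \<le> weight (\<lambda>e. real (card e)) q X"
  unfolding weight_def
proof (rule sum_mono)
  fix es assume es: "es \<in> X"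
  then have "hd es \<in> H" using assms by (metis edge_lists_def hd_in_set subsetD)
  then have "1 \<le> real (card (hd es))" using card_ge_2[of "hd es"] by simp
  then show "1 * q ^ card (\<Union>(set es)) \<le> real (card (hd es)) * q ^ card (\<Union>(set es))"
    using assms(3) by (intro mult_right_mono) auto
qed

lemma loose_ext_nonempty:
  assumes "\<And>es. es \<in> X \<Longrightarrow> es \<noteq> []" "es \<in> loose_ext H X"
  shows "es \<noteq> []"
  using assms(2) by cases (use assms(1) in auto)

definition "E\<^sub>0 = (\<Sum>e\<in>H. real (card e) * Q ^ card e)"

lemma weight_paths:
  assumes "0 \<le> q" "q \<le> Q"
  shows "weight (\<lambda>_. 1) q (loose_paths H) \<le> 2 * E\<^sub>0"
proof -
  have "weight (\<lambda>_. 1) q (loose_paths H) \<le> weight (\<lambda>e. real (card e)) q (loose_paths H)"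
    unfolding loose_paths_def
  proof (rule weight_one_le[OF edge_lists_loose_ext _ assms(1)])
    fix es assume "es \<in> loose_ext H ((\<lambda>e. [e]) ` H)"
    then show "es \<noteq> []" by (rule loose_ext_nonempty[rotated]) auto
  qed (auto simp: edge_lists_def)
  also have "\<dots> \<le> 2 * weight (\<lambda>e. real (card e)) q ((\<lambda>e. [e]) ` H)"
    unfolding loose_paths_def by (rule weight_loose_ext[OF _ assms]) (auto simp: edge_lists_def)
  also have "weight (\<lambda>e. real (card e)) q ((\<lambda>e. [e]) ` H) = (\<Sum>e\<in>H. real (card e) * q ^ card e)"
    unfolding weight_def by (subst sum.reindex) (auto simp: inj_on_def)
  also have "\<dots> \<le> E\<^sub>0" unfolding E\<^sub>0_def
    using assms by (intro sum_mono mult_left_mono power_mono) auto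
  finally show ?thesis by simp
qed

lemma weight_attach2:
  assumes "edge_lists X" "0 \<le> q" "q \<le> Q"
  shows "weight (\<lambda>_. 1) q (attach H ((=) 2) X) \<le> \<epsilon>\<^sub>2 * weight (\<lambda>_. 1) (2 * q) X"
proof (rule weight_attach[OF assms(1,2)])
  fix S :: "'a set" assume "2 = card S"
  then show "(\<Sum>f\<in>{f\<in>H. S \<subset> f}. 1 * q ^ (card f - card S)) \<le> \<epsilon>\<^sub>2"
    using deg2[of S] by (intro deg_mono[OF assms(2,3)]) auto
qed (use eps in auto)

lemma weight_attach3:
  assumes "edge_lists X" "0 \<le> q" "q \<le> Q"
  shows "weight (\<lambda>_. 1) q (attach H ((\<le>) 2) X) \<le> \<epsilon>\<^sub>3 * weight (\<lambda>_. 1) (2 * q) X"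
proof (rule weight_attach[OF assms(1,2)])
  fix S :: "'a set" assume "2 \<le> card S"
  then show "(\<Sum>f\<in>{f\<in>H. S \<subset> f}. 1 * q ^ (card f - card S)) \<le> \<epsilon>\<^sub>3"
    using deg3[of S] by (intro deg_mono[OF assms(2,3)]) auto
qed (use eps in auto)

lemma weight_cycles:
  assumes "0 \<le> q" "2 * q \<le> Q"
  shows "weight (\<lambda>_. 1) q (loose_cycles H) \<le> \<epsilon>\<^sub>2 * (2 * E\<^sub>0)"
proof -
  have "weight (\<lambda>_. 1) q (loose_cycles H) \<le> \<epsilon>\<^sub>2 * weight (\<lambda>_. 1) (2 * q) (loose_paths H)"
    unfolding loose_cycles_def using assms by (intro weight_attach2 edge_lists_paths) auto
  also have "\<dots> \<le> \<epsilon>\<^sub>2 * (2 * E\<^sub>0)"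
    using assms eps by (intro mult_left_mono weight_paths) auto
  finally show ?thesis .
qed

lemma weight_handles:
  assumes "0 \<le> q" "4 * q \<le> Q"
  shows "weight (\<lambda>_. 1) q (loose_ext H (attach H ((=) 1) (loose_cycles H))) \<le> \<epsilon>\<^sub>2 * (2 * E\<^sub>0)"
proof -
  let ?X = "attach H ((=) 1) (loose_cycles H)"
  have g: "edge_lists ?X" by (intro edge_lists_attach edge_lists_cycles)
  have "weight (\<lambda>_. 1) q (loose_ext H ?X) \<le> weight (\<lambda>e. real (card e)) q (loose_ext H ?X)"
  proof (rule weight_one_le[OF edge_lists_loose_ext[OF g] _ assms(1)])
    fix es assume "es \<in> loose_ext H ?X"
    then show "es \<noteq> []" by (rule loose_ext_nonempty[rotated]) (auto simp: attach_def)
  qed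
  also have "\<dots> \<le> 2 * weight (\<lambda>e. real (card e)) q ?X"
    using assms by (intro weight_loose_ext g) auto
  also have "weight (\<lambda>e. real (card e)) q ?X \<le> 1 / 2 * weight (\<lambda>_. 1) (2 * q) (loose_cycles H)"
  proof (rule weight_attach[OF edge_lists_cycles assms(1)])
    fix S :: "'a set" assume "1 = card S"
    then obtain v where S: "S = {v}" using card_1_singletonE[of S] by metis
    show "(\<Sum>f\<in>{f\<in>H. S \<subset> f}. real (card f) * q ^ (card f - card S)) \<le> 1 / 2"
      unfolding S by (rule deg_mono) (use deg1[of v] assms in simp_all)
  qed auto
  also have "weight (\<lambda>_. 1) (2 * q) (loose_cycles H) \<le> \<epsilon>\<^sub>2 * (2 * E\<^sub>0)"
    using assms by (intro weight_cycles) auto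
  finally show ?thesis by simp
qed

text \<open>Each dense list contains one overlap in two vertices and one further overlap. At most three
  choices of a set of old vertices are unrestricted, which explains the factor 8.\<close>

lemma weight_dense:
  assumes "0 \<le> q" "8 * q \<le> Q"
  shows "finite (dense_lists H)"
    and "(\<Sum>es\<in>dense_lists H. q ^ card (\<Union>(set es))) \<le> 6 * \<epsilon>\<^sub>2 * \<epsilon>\<^sub>3 * E\<^sub>0"
proof -
  let ?D1 = "attach H ((=) 2) (attach H ((\<le>) 2) (loose_paths H))"
  let ?D2 = "attach H ((\<le>) 2) (loose_cycles H)"
  let ?Z = "loose_ext H (attach H ((=) 1) (loose_cycles H))"
  let ?D3 = "attach H ((\<le>) 2) ?Z"
  have g: "edge_lists ?D1" "edge_lists ?D2" "edge_lists ?D3" "edge_lists ?Z"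
    by (intro edge_lists_attach edge_lists_loose_ext edge_lists_paths edge_lists_cycles)+
  have fin: "finite ?D1" "finite ?D2" "finite ?D3" using g edge_lists_finite by blast+
  then show "finite (dense_lists H)" unfolding dense_lists_def by simp
  have "weight (\<lambda>_. 1) q ?D1 \<le> \<epsilon>\<^sub>2 * weight (\<lambda>_. 1) (2 * q) (attach H ((\<le>) 2) (loose_paths H))"
    using assms by (intro weight_attach2 edge_lists_attach edge_lists_paths) auto
  also have "\<dots> \<le> \<epsilon>\<^sub>2 * (\<epsilon>\<^sub>3 * weight (\<lambda>_. 1) (2 * (2 * q)) (loose_paths H))"
    using assms eps by (intro mult_left_mono weight_attach3 edge_lists_paths) auto
  also have "\<dots> \<le> \<epsilon>\<^sub>2 * (\<epsilon>\<^sub>3 * (2 * E\<^sub>0))"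
    using assms eps by (intro mult_left_mono weight_paths) auto
  finally have 1: "weight (\<lambda>_. 1) q ?D1 \<le> \<epsilon>\<^sub>2 * (\<epsilon>\<^sub>3 * (2 * E\<^sub>0))" .
  have "weight (\<lambda>_. 1) q ?D2 \<le> \<epsilon>\<^sub>3 * weight (\<lambda>_. 1) (2 * q) (loose_cycles H)"
    using assms by (intro weight_attach3 edge_lists_cycles) auto
  also have "\<dots> \<le> \<epsilon>\<^sub>3 * (\<epsilon>\<^sub>2 * (2 * E\<^sub>0))"
    using assms eps by (intro mult_left_mono weight_cycles) auto
  finally have 2: "weight (\<lambda>_. 1) q ?D2 \<le> \<epsilon>\<^sub>3 * (\<epsilon>\<^sub>2 * (2 * E\<^sub>0))" .
  have "weight (\<lambda>_. 1) q ?D3 \<le> \<epsilon>\<^sub>3 * weight (\<lambda>_. 1) (2 * q) ?Z"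
    using assms g by (intro weight_attach3) auto
  also have "\<dots> \<le> \<epsilon>\<^sub>3 * (\<epsilon>\<^sub>2 * (2 * E\<^sub>0))"
    using assms eps by (intro mult_left_mono weight_handles) auto
  finally have 3: "weight (\<lambda>_. 1) q ?D3 \<le> \<epsilon>\<^sub>3 * (\<epsilon>\<^sub>2 * (2 * E\<^sub>0))" .
  have "(\<Sum>es\<in>dense_lists H. q ^ card (\<Union>(set es))) = weight (\<lambda>_. 1) q (?D1 \<union> ?D2 \<union> ?D3)"
    by (simp add: weight_def dense_lists_def)
  also have "\<dots> \<le> weight (\<lambda>_. 1) q (?D1 \<union> ?D2) + weight (\<lambda>_. 1) q ?D3"
    using fin assms by (intro weight_union) auto
  also have "weight (\<lambda>_. 1) q (?D1 \<union> ?D2) \<le> weight (\<lambda>_. 1) q ?D1 + weight (\<lambda>_. 1) q ?D2"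
    using fin assms by (intro weight_union) auto
  finally show "(\<Sum>es\<in>dense_lists H. q ^ card (\<Union>(set es))) \<le> 6 * \<epsilon>\<^sub>2 * \<epsilon>\<^sub>3 * E\<^sub>0"
    using 1 2 3 by (simp add: mult_ac)
qed

end


section \<open>Ranks of sets of columns\<close>

context vectorspace
begin

lemma ex_maximal_indpt:
  assumes "finite S" "B \<subseteq> S" "lin_indpt B"
  obtains U where "maximal U (\<lambda>T. T \<subseteq> S \<and> lin_indpt T)" "B \<subseteq> U" "finite U" "U \<subseteq> S"
proof -
  have "\<exists>U. finite U \<and> maximal U (\<lambda>T. T \<subseteq> S \<and> lin_indpt T) \<and> B \<subseteq> U"
    using assms by (intro maximal_exists_superset[of S]) auto
  then show ?thesis using that by (auto simp: maximal_def)
qed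

lemma lin_indpt_empty: "lin_indpt {}"
  by (simp add: lin_dep_def)

lemma dim_span_mono:
  assumes "S \<subseteq> T" "T \<subseteq> carrier V" "finite T"
  shows "vectorspace.dim K (span_vs S) \<le> vectorspace.dim K (span_vs T)"
proof -
  have S: "finite S" "S \<subseteq> carrier V" using assms finite_subset by auto
  obtain U where U: "maximal U (\<lambda>T. T \<subseteq> S \<and> lin_indpt T)" "{} \<subseteq> U" "finite U" "U \<subseteq> S"
    by (rule ex_maximal_indpt[OF S(1) empty_subsetI lin_indpt_empty])
  then have indpt: "lin_indpt U" and sub: "U \<subseteq> T" using assms(1) by (auto simp: maximal_def)
  obtain U' where U': "maximal U' (\<lambda>R. R \<subseteq> T \<and> lin_indpt R)" "U \<subseteq> U'" "finite U'" "U' \<subseteq> T"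
    by (rule ex_maximal_indpt[OF assms(3) sub indpt])
  have "card U \<le> card U'" using U' by (intro card_mono)
  then show ?thesis using dim_span[OF S(2,1) U(1)] dim_span[OF assms(2,3) U'(1)] by simp
qed

lemma dim_span_insert_le:
  assumes "S \<subseteq> carrier V" "finite S" "v \<in> carrier V"
  shows "vectorspace.dim K (span_vs (insert v S)) \<le> Suc (vectorspace.dim K (span_vs S))"
proof -
  have S: "finite (insert v S)" "insert v S \<subseteq> carrier V" using assms by auto
  obtain U where U: "maximal U (\<lambda>T. T \<subseteq> insert v S \<and> lin_indpt T)" "{} \<subseteq> U" "finite U" "U \<subseteq> insert v S"
    by (rule ex_maximal_indpt[OF S(1) empty_subsetI lin_indpt_empty])
  then have "lin_indpt U" by (simp add: maximal_def)
  then have indpt: "lin_indpt (U - {v})" by (rule subset_li_is_li) blast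
  have sub: "U - {v} \<subseteq> S" using U(4) by blast
  obtain U' where U': "maximal U' (\<lambda>R. R \<subseteq> S \<and> lin_indpt R)" "U - {v} \<subseteq> U'" "finite U'" "U' \<subseteq> S"
    by (rule ex_maximal_indpt[OF assms(2) sub indpt])
  have "card (U - {v}) \<le> card U'" using U' by (intro card_mono)
  moreover have "card U \<le> Suc (card (U - {v}))" using U(3) card_Suc_Diff1[of U v] by (cases "v \<in> U") auto
  ultimately show ?thesis using dim_span[OF S(2,1) U(1)] dim_span[OF assms(1,2) U'(1)] by simp
qed

lemma dim_span_insert_eq:
  assumes "S \<subseteq> carrier V" "v \<in> span S"
  shows "vectorspace.dim K (span_vs (insert v S)) = vectorspace.dim K (span_vs S)"
  using already_in_span[OF assms] by simp

end

definition (in vec_space) span_dim :: "'a vec set \<Rightarrow> nat" where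
  "span_dim S = vectorspace.dim class_ring (span_vs S)"

text \<open>Linear combinations are indexed by column numbers, not by the columns, since columns may coincide.\<close>

lemma (in vec_space) sum_cols_in_span:
  assumes A: "A \<in> carrier_mat n q" and X: "finite X" "X \<subseteq> {..<q}"
  shows "vec n (\<lambda>r. \<Sum>i\<in>X. c i * A $$ (r, i)) \<in> span (col A ` X)"
  using X
proof (induction X rule: finite_induct)
  case empty
  have "vec n (\<lambda>r. \<Sum>i\<in>{}. c i * A $$ (r, i)) = 0\<^sub>v n" by auto
  then show ?case using span_empty by simp
next
  case (insert j X)
  have colsC: "col A ` insert j X \<subseteq> carrier_vec n" using A by auto
  have "col A j \<in> span (col A ` insert j X)" using in_own_span[of "col A ` insert j X"] colsC by auto
  then have 1: "c j \<cdot>\<^sub>v col A j \<in> span (col A ` insert j X)"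
    using smult_in_span[OF colsC] by simp
  have "vec n (\<lambda>r. \<Sum>i\<in>X. c i * A $$ (r, i)) \<in> span (col A ` X)" using insert by simp
  moreover have "span (col A ` X) \<subseteq> span (col A ` insert j X)" by (intro span_is_monotone) auto
  ultimately have 2: "vec n (\<lambda>r. \<Sum>i\<in>X. c i * A $$ (r, i)) \<in> span (col A ` insert j X)" by blast
  have "c j \<cdot>\<^sub>v col A j + vec n (\<lambda>r. \<Sum>i\<in>X. c i * A $$ (r, i)) \<in> span (col A ` insert j X)"
    using span_add1[OF colsC 1 2] by simp
  moreover have "c j \<cdot>\<^sub>v col A j + vec n (\<lambda>r. \<Sum>i\<in>X. c i * A $$ (r, i))
      = vec n (\<lambda>r. \<Sum>i\<in>insert j X. c i * A $$ (r, i))"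
    using A insert by (intro eq_vecI) (auto simp: sum.insert)
  ultimately show ?case by simp
qed

definition col_rank :: "int mat \<Rightarrow> nat set \<Rightarrow> nat" where
  "col_rank M X = vec_space.span_dim (dim_row M) (col (map_mat rat_of_int M) ` X)"

definition kernel :: "int mat \<Rightarrow> (nat \<Rightarrow> int) \<Rightarrow> bool" where
  "kernel M x \<longleftrightarrow> (\<forall>r<dim_row M. (\<Sum>i<dim_col M. M $$ (r, i) * x i) = 0)"

lemma col_rank_mono:
  assumes "X \<subseteq> Y" "Y \<subseteq> {..<dim_col M}"
  shows "col_rank M X \<le> col_rank M Y"
proof -
  interpret vec_space "TYPE(rat)" "dim_row M" .
  have "finite Y" using assms(2) finite_subset by blast
  then show ?thesis unfolding col_rank_def span_dim_def
    using assms by (intro dim_span_mono) auto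
qed

lemma col_rank_insert_le:
  assumes "X \<subseteq> {..<dim_col M}" "j < dim_col M"
  shows "col_rank M (insert j X) \<le> Suc (col_rank M X)"
proof -
  interpret vec_space "TYPE(rat)" "dim_row M" .
  have "finite X" using assms(1) finite_subset by blast
  then show ?thesis unfolding col_rank_def span_dim_def image_insert
    using assms by (intro dim_span_insert_le) auto
qed

lemma col_rank_insert_eq:
  assumes X: "X \<subseteq> {..<dim_col M}" "j < dim_col M" "j \<notin> X"
    and x: "kernel M x" "x j \<noteq> 0" "\<And>i. i < dim_col M \<Longrightarrow> i \<notin> insert j X \<Longrightarrow> x i = 0"
  shows "col_rank M (insert j X) = col_rank M X"
proof -
  interpret vec_space "TYPE(rat)" "dim_row M" .
  let ?A = "map_mat rat_of_int M" and ?c = "\<lambda>i. - (rat_of_int (x i) / rat_of_int (x j))"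
  have finX: "finite X" using X(1) finite_subset by blast
  have "col ?A j = vec (dim_row M) (\<lambda>r. \<Sum>i\<in>X. ?c i * ?A $$ (r, i))"
  proof (rule eq_vecI)
    fix r assume "r < dim_vec (vec (dim_row M) (\<lambda>r. \<Sum>i\<in>X. ?c i * ?A $$ (r, i)))"
    then have r: "r < dim_row M" by simp
    have "(\<Sum>i<dim_col M. M $$ (r, i) * x i) = (\<Sum>i\<in>insert j X. M $$ (r, i) * x i)"
      using X x(3) by (intro sum.mono_neutral_right) auto
    then have "M $$ (r, j) * x j + (\<Sum>i\<in>X. M $$ (r, i) * x i) = 0"
      using x(1) r X(3) finX by (simp add: kernel_def)
    then have "rat_of_int (M $$ (r, j) * x j + (\<Sum>i\<in>X. M $$ (r, i) * x i)) = 0" by simp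
    then have *: "rat_of_int (M $$ (r, j)) * rat_of_int (x j)
        = - (\<Sum>i\<in>X. rat_of_int (M $$ (r, i)) * rat_of_int (x i))" by simp
    have "(\<Sum>i\<in>X. ?c i * ?A $$ (r, i))
        = - (\<Sum>i\<in>X. rat_of_int (M $$ (r, i)) * rat_of_int (x i)) / rat_of_int (x j)"
      unfolding sum_negf[symmetric] sum_divide_distrib using X r
      by (intro sum.cong) (auto simp: field_simps)
    also have "\<dots> = rat_of_int (M $$ (r, j))" unfolding *[symmetric] using x(2) by simp
    finally show "col ?A j $ r = vec (dim_row M) (\<lambda>r. \<Sum>i\<in>X. ?c i * ?A $$ (r, i)) $ r"
      using r X by simp
  qed simp
  then have "col ?A j \<in> span (col ?A ` X)"
    using sum_cols_in_span[of ?A "dim_col M" X ?c] finX X by simp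
  moreover have "col ?A ` X \<subseteq> carrier_vec (dim_row M)" using col_dim[of ?A] by auto
  ultimately show ?thesis unfolding col_rank_def span_dim_def image_insert
    by (intro dim_span_insert_eq) auto
qed

lemma mat_rank_eq_col_rank: "mat_rank M = col_rank M {..<dim_col M}"
proof -
  have "set (cols (map_mat rat_of_int M)) = col (map_mat rat_of_int M) ` {..<dim_col M}"
    by (auto simp: cols_def)
  then show ?thesis unfolding mat_rank_def col_rank_def vec_space.rank_def vec_space.span_dim_def
    by simp
qed

lemma mat_rank_restrict_compl:
  "mat_rank (restrict_compl M W) = col_rank M ({..<dim_col M} - W)"
proof -
  define J where "J = {..<dim_col M} - W"
  let ?N = "restrict_compl M W"
  have J: "{j. j < dim_col M \<and> j \<in> J} = J" by (auto simp: J_def)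
  have dims: "dim_row ?N = dim_row M" "dim_col ?N = card J"
    using J by (simp_all add: restrict_compl_def dim_submatrix J_def[symmetric])
  have pick: "pick J j < dim_col M" "pick J j \<in> J" if "j < card J" for j
    using that pick_le[of j "dim_col M" J] pick_in_set_le[of j J] J by auto
  have col: "col (map_mat rat_of_int ?N) j = col (map_mat rat_of_int M) (pick J j)" if "j < card J" for j
  proof (rule eq_vecI)
    fix i assume "i < dim_vec (col (map_mat rat_of_int M) (pick J j))"
    then have i: "i < dim_row M" by simp
    have "?N $$ (i, j) = M $$ (i, pick J j)"
      using i that J by (simp add: restrict_compl_def submatrix_index J_def[symmetric] pick_UNIV)
    then show "col (map_mat rat_of_int ?N) j $ i = col (map_mat rat_of_int M) (pick J j) $ i"
      using i that dims pick(1)[OF that] by simp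
  qed (simp add: dims)
  have "pick J ` {..<card J} = J"
  proof
    show "pick J ` {..<card J} \<subseteq> J" using pick by auto
    show "J \<subseteq> pick J ` {..<card J}"
    proof
      fix i assume "i \<in> J"
      then have "pick J (card {a\<in>J. a < i}) = i" by (rule pick_card_in_set)
      moreover have "card {a\<in>J. a < i} < card J"
        using \<open>i \<in> J\<close> by (intro psubset_card_mono) (auto simp: J_def)
      ultimately show "i \<in> pick J ` {..<card J}" by (intro image_eqI[of _ _ "card {a\<in>J. a < i}"]) auto
    qed
  qed
  then have "col (map_mat rat_of_int M) ` J = (\<lambda>j. col (map_mat rat_of_int M) (pick J j)) ` {..<card J}"
    by (metis image_image)
  also have "\<dots> = col (map_mat rat_of_int ?N) ` {..<dim_col ?N}"
    using col dims by (intro image_cong) auto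
  finally have eq: "col (map_mat rat_of_int M) ` J = col (map_mat rat_of_int ?N) ` {..<dim_col ?N}" .
  show ?thesis unfolding mat_rank_eq_col_rank J_def[symmetric]
    unfolding col_rank_def eq[symmetric] dims(1) by simp
qed


section \<open>Dimensions of coordinate projections\<close>

text \<open>From here on \<open>x $ i\<close> is an entry of a vector whose dimension is not part of its type.\<close>

unbundle no vec_syntax

text \<open>The dimension of the projection to the coordinates in \<open>U\<close> of the kernel of \<open>M\<close>. In terms of the columns
  of \<open>M\<close> it is the rank of \<open>U\<close> in the dual of their matroid.\<close>

definition proj_dim :: "int mat \<Rightarrow> nat set \<Rightarrow> nat" where
  "proj_dim M U = card U + col_rank M ({..<dim_col M} - U) - col_rank M {..<dim_col M}"

lemma col_rank_le_compl:
  assumes "U \<subseteq> {..<dim_col M}"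
  shows "col_rank M {..<dim_col M} \<le> card U + col_rank M ({..<dim_col M} - U)"
proof -
  have "finite U" using assms finite_subset by blast
  then show ?thesis using assms
  proof (induction U rule: finite_induct)
    case (insert j U)
    have "{..<dim_col M} - U = insert j ({..<dim_col M} - insert j U)" using insert by auto
    then have "col_rank M ({..<dim_col M} - U) \<le> Suc (col_rank M ({..<dim_col M} - insert j U))"
      using insert.prems col_rank_insert_le[of "{..<dim_col M} - insert j U" M j] by auto
    then show ?case using insert by simp
  qed simp
qed

lemma proj_dim_add:
  assumes "U \<subseteq> {..<dim_col M}"
  shows "proj_dim M U + col_rank M {..<dim_col M} = card U + col_rank M ({..<dim_col M} - U)"
  using col_rank_le_compl[OF assms] by (simp add: proj_dim_def)

lemma proj_dim_empty: "proj_dim M {} = 0"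
  by (simp add: proj_dim_def)

lemma proj_dim_insert:
  assumes "U \<subseteq> {..<dim_col M}" "j < dim_col M" "j \<notin> U"
  shows "proj_dim M U \<le> proj_dim M (insert j U)" "proj_dim M (insert j U) \<le> Suc (proj_dim M U)"
proof -
  have U: "finite U" "insert j U \<subseteq> {..<dim_col M}" using assms finite_subset by auto
  have eq: "{..<dim_col M} - U = insert j ({..<dim_col M} - insert j U)" using assms by auto
  have "col_rank M ({..<dim_col M} - U) \<le> Suc (col_rank M ({..<dim_col M} - insert j U))"
    unfolding eq using assms by (intro col_rank_insert_le) auto
  moreover have "col_rank M ({..<dim_col M} - insert j U) \<le> col_rank M ({..<dim_col M} - U)"
    by (intro col_rank_mono) auto
  moreover have "card (insert j U) = Suc (card U)" using U assms by simp
  ultimately show "proj_dim M U \<le> proj_dim M (insert j U)" "proj_dim M (insert j U) \<le> Suc (proj_dim M U)"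
    using proj_dim_add[OF assms(1)] proj_dim_add[OF U(2)] by linarith+
qed

lemma proj_dim_insert_free:
  assumes "U \<subseteq> {..<dim_col M}" "j < dim_col M" "j \<notin> U"
    and x: "kernel M x" "x j \<noteq> 0" "\<And>i. i \<in> U \<Longrightarrow> x i = 0"
  shows "proj_dim M (insert j U) = Suc (proj_dim M U)"
proof -
  have U: "finite U" "insert j U \<subseteq> {..<dim_col M}" using assms finite_subset by auto
  have eq: "{..<dim_col M} - U = insert j ({..<dim_col M} - insert j U)" using assms by auto
  have "col_rank M ({..<dim_col M} - U) = col_rank M ({..<dim_col M} - insert j U)"
    unfolding eq using assms by (intro col_rank_insert_eq[OF _ _ _ x(1,2)]) auto
  moreover have "card (insert j U) = Suc (card U)" using U assms by simp
  ultimately show ?thesis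
    using proj_dim_add[OF assms(1)] proj_dim_add[OF U(2)] by linarith
qed

lemma proj_dim_mono:
  assumes "S \<subseteq> U" "U \<subseteq> {..<dim_col M}"
  shows "proj_dim M S \<le> proj_dim M U"
proof -
  have "finite (U - S)" using assms finite_subset by blast
  have *: "proj_dim M S \<le> proj_dim M (S \<union> D)" if "finite D" "D \<inter> S = {}" "D \<subseteq> {..<dim_col M}" for D
    using that
  proof (induction D rule: finite_induct)
    case (insert j D)
    have "S \<union> D \<subseteq> {..<dim_col M}" using insert assms by auto
    then have "proj_dim M (S \<union> D) \<le> proj_dim M (insert j (S \<union> D))"
      using insert by (intro proj_dim_insert) auto
    then show ?case using insert by simp
  qed simp
  have "U = S \<union> (U - S)" using assms by blast
  then show ?thesis using *[of "U - S"] \<open>finite (U - S)\<close> assms by auto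
qed

lemma mult_mat_vec_sum:
  assumes "x \<in> carrier_vec (dim_col M)" "r < dim_row M"
  shows "(M *\<^sub>v x) $ r = (\<Sum>i<dim_col M. M $$ (r, i) * x $ i)"
  using assms by (simp add: scalar_prod_def lessThan_atLeast0)

lemma kernel_diff:
  assumes "x \<in> carrier_vec (dim_col M)" "y \<in> carrier_vec (dim_col M)" "M *\<^sub>v x = M *\<^sub>v y"
  shows "kernel M (\<lambda>i. x $ i - y $ i)"
  unfolding kernel_def
proof (intro allI impI)
  fix r assume "r < dim_row M"
  then show "(\<Sum>i<dim_col M. M $$ (r, i) * (x $ i - y $ i)) = 0"
    using mult_mat_vec_sum[OF assms(1)] mult_mat_vec_sum[OF assms(2)] assms(3)
    by (simp add: right_diff_distrib sum_subtractf)
qed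

lemma kernel_solution:
  assumes "solution_in (M, 0\<^sub>v (dim_row M)) S x"
  shows "kernel M (\<lambda>i. x $ i)"
  unfolding kernel_def
proof (intro allI impI)
  fix r assume r: "r < dim_row M"
  have x: "x \<in> carrier_vec (dim_col M)" "M *\<^sub>v x = 0\<^sub>v (dim_row M)"
    using assms by (auto simp: solution_in_def)
  show "(\<Sum>i<dim_col M. M $$ (r, i) * x $ i) = 0"
    using mult_mat_vec_sum[OF x(1) r] r unfolding x(2) by simp
qed

lemma solution_in_dim:
  assumes "solution_in A S x"
  shows "dim_vec x = dim_col (fst A)"
proof -
  have "x \<in> carrier_vec (dim_col (fst A))" using assms unfolding solution_in_def by blast
  then show ?thesis by (rule carrier_vecD)
qed

lemma solution_in_entry:
  assumes "solution_in A S x" "i < dim_col (fst A)"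
  shows "x $ i \<in> S"
proof -
  have "x $ i \<in> vec_set x" using assms(2) solution_in_dim[OF assms(1)] by (intro vec_setI) auto
  then show ?thesis using assms(1) unfolding solution_in_def by blast
qed

lemma kernel_combine:
  assumes "kernel M x" "kernel M y"
  shows "kernel M (\<lambda>i. a * x i - b * y i)"
  unfolding kernel_def
proof (intro allI impI)
  fix r assume r: "r < dim_row M"
  have "(\<Sum>i<dim_col M. M $$ (r, i) * (a * x i - b * y i))
     = a * (\<Sum>i<dim_col M. M $$ (r, i) * x i) - b * (\<Sum>i<dim_col M. M $$ (r, i) * y i)"
    by (simp add: sum_distrib_left sum_subtractf right_diff_distrib mult.left_commute)
  then show "(\<Sum>i<dim_col M. M $$ (r, i) * (a * x i - b * y i)) = 0"
    using assms r by (simp add: kernel_def)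
qed

text \<open>If all solutions had the ratio \<open>a / b\<close> at \<open>i\<close> and \<open>j\<close>, then the exponents of \<open>p\<close> in the two entries would differ
  by a fixed nonzero number, for some prime \<open>p\<close>. Colour the integers by this exponent modulo a number that is
  larger than the difference.\<close>

lemma partition_regular_not_proportional:
  fixes a b :: int
  assumes "partition_regular M" "i < dim_col M" "j < dim_col M" "0 < a" "0 < b" "a \<noteq> b"
  obtains x where "kernel M x" "x i * b \<noteq> x j * a"
proof -
  obtain p where p: "prime p" "multiplicity p a \<noteq> multiplicity p b"
    using multiplicity_eq_int[of a b] assms(4-6) by blast
  define N where "N = multiplicity p a + multiplicity p b + 1"
  define \<kappa> where "\<kappa> s = multiplicity p s mod N" for s :: int
  have "\<kappa> ` {1..} \<subseteq> {..<N}" by (auto simp: \<kappa>_def N_def)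
  then have "finite (\<kappa> ` {1..})" using finite_subset by blast
  then obtain x r where x: "solution_in (M, 0\<^sub>v (dim_row M)) {s. 1 \<le> s \<and> \<kappa> s = r} x"
    using assms(1) unfolding partition_regular_def by blast
  have xi: "1 \<le> x $ i" "\<kappa> (x $ i) = r" and xj: "1 \<le> x $ j" "\<kappa> (x $ j) = r"
    using solution_in_entry[OF x, of i] solution_in_entry[OF x, of j] assms(2,3) by auto
  have "x $ i * b \<noteq> x $ j * a"
  proof
    assume eq: "x $ i * b = x $ j * a"
    have "multiplicity p (x $ i) + multiplicity p b = multiplicity p (x $ i * b)"
      using p(1) xi assms by (intro prime_elem_multiplicity_mult_distrib[symmetric]) auto
    also have "\<dots> = multiplicity p (x $ j) + multiplicity p a"
      unfolding eq using p(1) xj assms by (intro prime_elem_multiplicity_mult_distrib) auto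
    finally have "int (multiplicity p b) - int (multiplicity p a)
        = int (multiplicity p (x $ j)) - int (multiplicity p (x $ i))" by simp
    moreover have "int (multiplicity p (x $ j)) mod int N = int (multiplicity p (x $ i)) mod int N"
      using xi xj by (simp add: \<kappa>_def flip: zmod_int)
    ultimately have "int N dvd int (multiplicity p b) - int (multiplicity p a)"
      by (simp add: mod_eq_dvd_iff)
    moreover have "\<bar>int (multiplicity p b) - int (multiplicity p a)\<bar> < int N" by (simp add: N_def)
    ultimately have "int (multiplicity p b) - int (multiplicity p a) = 0"
      by (metis dvd_imp_le_int linorder_not_le abs_of_nat)
    then show False using p(2) by simp
  qed
  then show ?thesis using that[of "\<lambda>i. x $ i"] kernel_solution[OF x] by simp
qed

text \<open>A solution with positive distinct entries shows that coordinate \<open>i\<close> does not vanish on the kernel. A combination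
  of it with a solution that has another ratio at \<open>i\<close> and \<open>j\<close> vanishes at \<open>i\<close> and not at \<open>j\<close>.\<close>

lemma proj_dim_small:
  assumes "irredundant M" "partition_regular M" "i < dim_col M" "j < dim_col M" "i \<noteq> j"
  shows "proj_dim M {i} = 1" "proj_dim M {i, j} = 2"
proof -
  obtain x0 where x0: "distinct_solution_in (M, 0\<^sub>v (dim_row M)) {1..} x0"
    using assms(1) unfolding irredundant_def by blast
  then have sol: "solution_in (M, 0\<^sub>v (dim_row M)) {1..} x0" and inj: "inj_on (\<lambda>i. x0 $ i) {..<dim_vec x0}"
    by (auto simp: distinct_solution_in_def)
  have d: "dim_vec x0 = dim_col M" using solution_in_dim[OF sol] by simp
  have pos: "0 < x0 $ i" "0 < x0 $ j"
    using solution_in_entry[OF sol, of i] solution_in_entry[OF sol, of j] assms by auto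
  have ne: "x0 $ i \<noteq> x0 $ j" using inj assms d by (auto simp: inj_on_def)
  have "proj_dim M (insert i {}) = Suc (proj_dim M {})"
    using pos assms(3) by (intro proj_dim_insert_free[OF _ _ _ kernel_solution[OF sol]]) auto
  then show 1: "proj_dim M {i} = 1" by (simp add: proj_dim_empty)
  obtain x where x: "kernel M x" "x i * x0 $ j \<noteq> x j * x0 $ i"
    using partition_regular_not_proportional[OF assms(2,3,4) pos ne] by blast
  have "proj_dim M (insert j {i}) = Suc (proj_dim M {i})"
    using x assms
    by (intro proj_dim_insert_free[OF _ _ _ kernel_combine[OF x(1) kernel_solution[OF sol], of "x0 $ i" "x i"]])
       (auto simp: mult.commute)
  then show "proj_dim M {i, j} = 2" using 1 by (simp add: insert_commute)
qed

lemma proj_dim_ge_2: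
  assumes "irredundant M" "partition_regular M" "W \<subseteq> {..<dim_col M}" "2 \<le> card W"
  shows "2 \<le> proj_dim M W"
proof -
  obtain i j where ij: "i \<in> W" "j \<in> W" "i \<noteq> j"
    using assms(4) by (metis card_2_iff obtain_subset_with_card_n insert_subset)
  then have "proj_dim M {i, j} \<le> proj_dim M W" using assms by (intro proj_dim_mono) auto
  moreover have "i < dim_col M" "j < dim_col M" using ij assms(3) by auto
  ultimately show ?thesis using proj_dim_small(2)[OF assms(1,2) _ _ ij(3)] by simp
qed

text \<open>Reveal the coordinates in \<open>U\<close> one at a time. Either \<open>proj_dim\<close> grows by one, and there are at most \<open>n\<close>
  possible values, or it does not, and the new coordinate is determined by those already revealed.\<close>

lemma card_restrict_solutions:
  assumes F: "\<And>x i. x \<in> F \<Longrightarrow> i < dim_col M \<Longrightarrow> x i \<in> {1..int n}"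
    and ker: "\<And>x y. x \<in> F \<Longrightarrow> y \<in> F \<Longrightarrow> kernel M (\<lambda>i. x i - y i)"
    and agree: "\<And>x y i. x \<in> F \<Longrightarrow> y \<in> F \<Longrightarrow> i \<in> S \<Longrightarrow> x i = y i"
    and SU: "S \<subseteq> U" "U \<subseteq> {..<dim_col M}"
  shows "card ((\<lambda>x. restrict x U) ` F) \<le> n ^ (proj_dim M U - proj_dim M S)"
proof -
  have fin: "finite ((\<lambda>x. restrict x V) ` F)" if "V \<subseteq> {..<dim_col M}" for V
  proof (rule finite_subset)
    show "(\<lambda>x. restrict x V) ` F \<subseteq> V \<rightarrow>\<^sub>E {1..int n}" using F that by auto
    show "finite (V \<rightarrow>\<^sub>E {1..int n})" using that finite_subset by (intro finite_PiE) auto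
  qed
  have *: "card ((\<lambda>x. restrict x (S \<union> D)) ` F) \<le> n ^ (proj_dim M (S \<union> D) - proj_dim M S)"
    if "finite D" "D \<inter> S = {}" "D \<subseteq> {..<dim_col M}" for D
    using that
  proof (induction D rule: finite_induct)
    case empty
    have eq: "restrict x S = restrict y S" if "x \<in> F" "y \<in> F" for x y
      using agree[OF that] by auto
    have "card ((\<lambda>x. restrict x S) ` F) \<le> 1"
    proof (cases "F = {}")
      case False
      then obtain x where "x \<in> F" by blast
      then have "(\<lambda>x. restrict x S) ` F \<subseteq> {restrict x S}" using eq by blast
      then have "card ((\<lambda>x. restrict x S) ` F) \<le> card {restrict x S}" by (intro card_mono) auto
      then show ?thesis by simp
    qed simp
    then show ?case by (simp only: Un_empty_right diff_self_eq_0 power_0)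
  next
    case (insert j D)
    define V where "V = S \<union> D"
    have V: "V \<subseteq> {..<dim_col M}" "j < dim_col M" "j \<notin> V" "insert j V \<subseteq> {..<dim_col M}"
      using insert SU by (auto simp: V_def)
    have IH: "card ((\<lambda>x. restrict x V) ` F) \<le> n ^ (proj_dim M V - proj_dim M S)"
      unfolding V_def by (rule insert.IH) (use insert.prems in auto)
    have mono: "proj_dim M S \<le> proj_dim M V" using V(1) by (intro proj_dim_mono) (auto simp: V_def)
    have "card ((\<lambda>x. restrict x (insert j V)) ` F) \<le> n ^ (proj_dim M (insert j V) - proj_dim M S)"
    proof (cases "proj_dim M (insert j V) = Suc (proj_dim M V)")
      case True
      have "restrict x (insert j V) = (restrict x V)(j := x j)" for x :: "nat \<Rightarrow> int"
        by (auto simp: restrict_def)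
      then have sub: "(\<lambda>x. restrict x (insert j V)) ` F
          \<subseteq> (\<lambda>(y, v). y(j := v)) ` (((\<lambda>x. restrict x V) ` F) \<times> {1..int n})"
        using F V(2) by force
      have "card ((\<lambda>x. restrict x (insert j V)) ` F) \<le> card (((\<lambda>x. restrict x V) ` F) \<times> {1..int n})"
        using fin[OF V(1)] by (intro surj_card_le[OF _ sub]) auto
      also have "\<dots> \<le> n ^ (proj_dim M V - proj_dim M S) * n"
        using IH by (simp add: card_cartesian_product)
      also have "\<dots> = n ^ (proj_dim M (insert j V) - proj_dim M S)"
        using True mono by (simp add: Suc_diff_le)
      finally show ?thesis .
    next
      case False
      then have eqd: "proj_dim M (insert j V) = proj_dim M V"
        using proj_dim_insert[OF V(1,2,3)] by linarith
      have det: "x j = y j" if xy: "x \<in> F" "y \<in> F" and r: "restrict x V = restrict y V" for x y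
      proof (rule ccontr)
        assume "x j \<noteq> y j"
        moreover have "x i = y i" if "i \<in> V" for i using r that by (metis restrict_apply')
        ultimately have "proj_dim M (insert j V) = Suc (proj_dim M V)"
          by (intro proj_dim_insert_free[OF V(1,2,3) ker[OF xy]]) auto
        then show False using False by simp
      qed
      have rr: "restrict (restrict x (insert j V)) V = restrict x V" for x :: "nat \<Rightarrow> int"
        by (auto simp: restrict_def)
      have "inj_on (\<lambda>y. restrict y V) ((\<lambda>x. restrict x (insert j V)) ` F)"
      proof (rule inj_onI)
        fix u w assume u: "u \<in> (\<lambda>x. restrict x (insert j V)) ` F" and w: "w \<in> (\<lambda>x. restrict x (insert j V)) ` F"
          and eq: "restrict u V = restrict w V"
        obtain x where x: "x \<in> F" "u = restrict x (insert j V)" using u by blast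
        obtain y where y: "y \<in> F" "w = restrict y (insert j V)" using w by blast
        have r: "restrict x V = restrict y V" using eq unfolding x(2) y(2) rr .
        then have "x i = y i" if "i \<in> insert j V" for i
          using det[OF x(1) y(1) r] that by (cases "i = j") (auto dest: fun_cong[of _ _ i])
        then show "u = w" unfolding x(2) y(2) by auto
      qed
      moreover have "(\<lambda>y. restrict y V) ` (\<lambda>x. restrict x (insert j V)) ` F \<subseteq> (\<lambda>x. restrict x V) ` F"
        by (simp add: image_image Int_absorb1 subset_insertI)
      ultimately have "card ((\<lambda>x. restrict x (insert j V)) ` F) \<le> card ((\<lambda>x. restrict x V) ` F)"
        using fin[OF V(1)] by (rule card_inj_on_le)
      then show ?thesis using IH eqd by simp
    qed
    then show ?case unfolding V_def by (simp only: Un_insert_right)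
  qed
  have "finite (U - S)" using SU finite_subset by blast
  moreover have "S \<union> (U - S) = U" using SU by blast
  ultimately show ?thesis using *[of "U - S"] SU by auto
qed

definition solution_edges :: "lin_system \<Rightarrow> nat set \<Rightarrow> nat \<Rightarrow> int set set" where
  "solution_edges A W n = (\<lambda>x. (\<lambda>i. x $ i) ` W) ` {x. distinct_solution_in A {1..int n} x}"

lemma solution_edgesD:
  assumes "e \<in> solution_edges A W n" "W \<subseteq> {..<dim_col (fst A)}"
  shows "card e = card W" "e \<subseteq> {1..int n}"
proof -
  obtain x where x: "distinct_solution_in A {1..int n} x" "e = (\<lambda>i. x $ i) ` W"
    using assms(1) unfolding solution_edges_def by blast
  then have sol: "solution_in A {1..int n} x" and inj: "inj_on (\<lambda>i. x $ i) {..<dim_vec x}"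
    by (auto simp: distinct_solution_in_def)
  have d: "dim_vec x = dim_col (fst A)" using solution_in_dim[OF sol] .
  show "card e = card W" unfolding x(2)
    using inj_on_subset[OF inj] assms(2) d by (intro card_image) simp
  show "e \<subseteq> {1..int n}" unfolding x(2) using solution_in_entry[OF sol] assms(2) by blast
qed

text \<open>The first factor counts the positions \<open>h v\<close> at which the elements \<open>v\<close> of \<open>S\<close> can occur.\<close>

lemma card_solution_edges_containing:
  assumes W: "W \<subseteq> {..<dim_col (fst A)}" and S: "finite S" and n: "1 \<le> n"
    and D: "\<And>R. R \<subseteq> W \<Longrightarrow> card R = card S \<Longrightarrow> proj_dim (fst A) W - proj_dim (fst A) R \<le> D"
  shows "card {e \<in> solution_edges A W n. S \<subseteq> e} \<le> card W ^ card S * n ^ D"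
proof -
  define F where "F h = (\<lambda>x i. x $ i) ` {x. distinct_solution_in A {1..int n} x \<and> (\<forall>v\<in>S. x $ h v = v)}"
    for h :: "int \<Rightarrow> nat"
  have finW: "finite W" using W finite_subset by blast
  have sub: "{e \<in> solution_edges A W n. S \<subseteq> e} \<subseteq> (\<Union>h\<in>S \<rightarrow>\<^sub>E W. (\<lambda>x. x ` W) ` F h)"
  proof
    fix e assume "e \<in> {e \<in> solution_edges A W n. S \<subseteq> e}"
    then obtain x where x: "distinct_solution_in A {1..int n} x" "e = (\<lambda>i. x $ i) ` W" "S \<subseteq> e"
      unfolding solution_edges_def by blast
    then have "\<forall>v\<in>S. \<exists>i\<in>W. x $ i = v" by blast
    then obtain h where h: "\<forall>v\<in>S. h v \<in> W \<and> x $ h v = v" by metis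
    have "restrict h S \<in> S \<rightarrow>\<^sub>E W" using h by auto
    moreover have "(\<lambda>i. x $ i) \<in> F (restrict h S)" unfolding F_def using x(1) h by auto
    ultimately show "e \<in> (\<Union>h\<in>S \<rightarrow>\<^sub>E W. (\<lambda>x. x ` W) ` F h)" using x(2) by blast
  qed
  have each: "finite ((\<lambda>x. x ` W) ` F h) \<and> card ((\<lambda>x. x ` W) ` F h) \<le> n ^ D" if h: "h \<in> S \<rightarrow>\<^sub>E W" for h
  proof (cases "F h = {}")
    case False
    then obtain x0 where x0: "\<forall>v\<in>S. x0 $ h v = v" unfolding F_def by blast
    then have "inj_on h S" by (metis inj_onI)
    then have cR: "card (h ` S) = card S" by (rule card_image)
    have hS: "h ` S \<subseteq> W" using h by auto
    have Fx: "\<exists>y. x = (\<lambda>i. y $ i) \<and> solution_in A {1..int n} y \<and> (\<forall>v\<in>S. y $ h v = v)" if "x \<in> F h" for x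
      using that unfolding F_def distinct_solution_in_def by blast
    have le: "card ((\<lambda>x. restrict x W) ` F h) \<le> n ^ (proj_dim (fst A) W - proj_dim (fst A) (h ` S))"
    proof (rule card_restrict_solutions[OF _ _ _ hS W])
      fix x i assume "x \<in> F h" "i < dim_col (fst A)"
      then show "x i \<in> {1..int n}" using Fx solution_in_entry by blast
    next
      fix x y assume "x \<in> F h" "y \<in> F h"
      then obtain u w where "x = (\<lambda>i. u $ i)" "y = (\<lambda>i. w $ i)" "solution_in A {1..int n} u"
        "solution_in A {1..int n} w" using Fx by blast
      then show "kernel (fst A) (\<lambda>i. x i - y i)"
        by (auto simp: solution_in_def intro!: kernel_diff)
    next
      fix x y i assume x: "x \<in> F h" and y: "y \<in> F h" and "i \<in> h ` S"
      then obtain v where v: "v \<in> S" "i = h v" by blast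
      show "x i = y i" using Fx[OF x] Fx[OF y] v by auto
    qed
    have eq: "(\<lambda>x. x ` W) ` F h = (\<lambda>y. y ` W) ` (\<lambda>x. restrict x W) ` F h"
      by (simp add: image_image)
    have fin: "finite ((\<lambda>x. restrict x W) ` F h)"
    proof (rule finite_subset)
      show "(\<lambda>x. restrict x W) ` F h \<subseteq> W \<rightarrow>\<^sub>E {1..int n}"
      proof (intro image_subsetI restrict_PiE_iff[THEN iffD2] ballI)
        fix x i assume x: "x \<in> F h" and "i \<in> W"
        then have "i < dim_col (fst A)" using W by blast
        then show "x i \<in> {1..int n}" using Fx[OF x] solution_in_entry by blast
      qed
      show "finite (W \<rightarrow>\<^sub>E {1..int n})" using finW by (intro finite_PiE) auto
    qed
    have "card ((\<lambda>x. x ` W) ` F h) \<le> card ((\<lambda>x. restrict x W) ` F h)"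
      unfolding eq by (rule card_image_le[OF fin])
    also note le
    also have "n ^ (proj_dim (fst A) W - proj_dim (fst A) (h ` S)) \<le> n ^ D"
      using D[OF hS cR] n by (intro power_increasing) auto
    finally show ?thesis unfolding eq using fin by blast
  qed simp
  have finP: "finite (S \<rightarrow>\<^sub>E W)" using S finW by (intro finite_PiE) auto
  have "card {e \<in> solution_edges A W n. S \<subseteq> e} \<le> card (\<Union>h\<in>S \<rightarrow>\<^sub>E W. (\<lambda>x. x ` W) ` F h)"
    using finP each by (intro card_mono[OF _ sub] finite_UN_I) auto
  also have "\<dots> \<le> (\<Sum>h\<in>S \<rightarrow>\<^sub>E W. card ((\<lambda>x. x ` W) ` F h))" by (rule card_UN_le[OF finP])
  also have "\<dots> \<le> (\<Sum>h\<in>S \<rightarrow>\<^sub>E W. n ^ D)" using each by (intro sum_mono) blast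
  also have "\<dots> = card W ^ card S * n ^ D" using S by (simp add: card_PiE)
  finally show ?thesis .
qed


section \<open>The random set\<close>

lemma prob_random_subset_superset:
  assumes p: "0 \<le> p" "p \<le> 1" and T: "T \<subseteq> {1..int n}"
  shows "measure_pmf.prob (random_subset n p) {S. T \<subseteq> S} = p ^ card T"
proof -
  have eq: "(\<lambda>f. {i \<in> {1..int n}. f i}) -` {S. T \<subseteq> S}
      = Pi {1..int n} (\<lambda>i. if i \<in> T then {True} else UNIV)"
    using T by (auto simp: Pi_def split: if_splits)
  have "measure_pmf.prob (random_subset n p) {S. T \<subseteq> S}
      = (\<Prod>i\<in>{1..int n}. measure_pmf.prob (bernoulli_pmf p) (if i \<in> T then {True} else UNIV))"
    unfolding random_subset_def measure_map_pmf eq by (rule measure_Pi_pmf_Pi) simp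
  also have "\<dots> = (\<Prod>i\<in>{1..int n}. if i \<in> T then p else 1)"
    using p by (intro prod.cong) (auto simp: measure_pmf_single)
  also have "\<dots> = (\<Prod>i\<in>{1..int n} \<inter> T. p)"
    by (rule prod.inter_restrict[symmetric]) simp
  also have "{1..int n} \<inter> T = T" using T by blast
  finally show ?thesis by simp
qed

lemma prob_random_subset_list_le:
  assumes p: "0 \<le> p" "p \<le> 1" and D: "finite D" "\<And>es. es \<in> D \<Longrightarrow> \<Union>(set es) \<subseteq> {1..int n}"
  shows "measure_pmf.prob (random_subset n p) {S. \<exists>es\<in>D. \<Union>(set es) \<subseteq> S}
    \<le> (\<Sum>es\<in>D. p ^ card (\<Union>(set es)))"
proof -
  have "{S. \<exists>es\<in>D. \<Union>(set es) \<subseteq> S} = (\<Union>es\<in>D. {S. \<Union>(set es) \<subseteq> S})" by blast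
  then have "measure_pmf.prob (random_subset n p) {S. \<exists>es\<in>D. \<Union>(set es) \<subseteq> S}
      \<le> (\<Sum>es\<in>D. measure_pmf.prob (random_subset n p) {S. \<Union>(set es) \<subseteq> S})"
    using measure_pmf.finite_measure_subadditive_finite[OF D(1),
        of "\<lambda>es. {S. \<Union>(set es) \<subseteq> S}" "random_subset n p"] by simp
  also have "\<dots> = (\<Sum>es\<in>D. p ^ card (\<Union>(set es)))"
    using D p by (intro sum.cong refl prob_random_subset_superset) auto
  finally show ?thesis .
qed

lemma set_pmf_random_subset: "S \<in> set_pmf (random_subset n p) \<Longrightarrow> S \<subseteq> {1..int n}"
  by (auto simp: random_subset_def)

lemma solution_edges_restrict:
  assumes "distinct_solution_in A R x" "R \<subseteq> {1..int n}" "W \<subseteq> {..<dim_col (fst A)}"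
  shows "(\<lambda>i. x $ i) ` W \<in> solution_edges A W n" "(\<lambda>i. x $ i) ` W \<subseteq> R"
proof -
  have sol: "solution_in A R x" using assms(1) by (simp add: distinct_solution_in_def)
  have "distinct_solution_in A {1..int n} x"
    using assms(1,2) unfolding distinct_solution_in_def solution_in_def by blast
  then show "(\<lambda>i. x $ i) ` W \<in> solution_edges A W n" unfolding solution_edges_def by blast
  show "(\<lambda>i. x $ i) ` W \<subseteq> R" using solution_in_entry[OF sol] assms(3) by blast
qed

lemma finite_solution_edges:
  assumes "W \<subseteq> {..<dim_col (fst A)}"
  shows "finite (solution_edges A W n)"
proof (rule finite_subset)
  show "solution_edges A W n \<subseteq> Pow {1..int n}" using solution_edgesD(2)[OF _ assms] by blast
qed simp

text \<open>A proper colouring of the edges of the two systems inside \<open>S\<close> would give a colouring of \<open>S\<close> without solutions.\<close>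

lemma rado_dense:
  assumes S: "S \<subseteq> {1..int n}" "rado A B S"
    and V: "V \<subseteq> {..<dim_col (fst A)}" "3 \<le> card V"
    and W: "W \<subseteq> {..<dim_col (fst B)}" "3 \<le> card W"
  shows "\<exists>es\<in>dense_lists (solution_edges A V n \<union> solution_edges B W n). \<Union>(set es) \<subseteq> S"
proof -
  define \<A> where "\<A> = {e \<in> solution_edges A V n. e \<subseteq> S}"
  define \<B> where "\<B> = {e \<in> solution_edges B W n. e \<subseteq> S}"
  have "\<not> colourable \<A> \<B>"
  proof
    assume "colourable \<A> \<B>"
    then obtain \<phi> where \<phi>: "\<forall>e\<in>\<A>. \<exists>v\<in>e. \<not> \<phi> v" "\<forall>e\<in>\<B>. \<exists>v\<in>e. \<phi> v"
      unfolding colourable_def by (elim exE conjE)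
    define \<kappa> :: "int \<Rightarrow> nat" where "\<kappa> s = (if \<phi> s then 1 else 2)" for s
    have "\<forall>s\<in>S. \<kappa> s \<in> {1, 2}" by (simp add: \<kappa>_def)
    then consider x where "distinct_solution_in A {s \<in> S. \<kappa> s = 1} x"
      | x where "distinct_solution_in B {s \<in> S. \<kappa> s = 2} x"
      using S(2) unfolding rado_def by blast
    then show False
    proof cases
      case 1
      have "{s \<in> S. \<kappa> s = 1} \<subseteq> {1..int n}" using S by blast
      note e = solution_edges_restrict[OF 1 this V(1)]
      then have "(\<lambda>i. x $ i) ` V \<in> \<A>" by (auto simp: \<A>_def)
      then obtain v where "v \<in> (\<lambda>i. x $ i) ` V" "\<not> \<phi> v" using \<phi>(1) by blast
      then have "\<kappa> v = 1" using e(2) by blast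
      then show False using \<open>\<not> \<phi> v\<close> by (simp add: \<kappa>_def)
    next
      case 2
      have "{s \<in> S. \<kappa> s = 2} \<subseteq> {1..int n}" using S by blast
      note e = solution_edges_restrict[OF 2 this W(1)]
      then have "(\<lambda>i. x $ i) ` W \<in> \<B>" by (auto simp: \<B>_def)
      then obtain v where "v \<in> (\<lambda>i. x $ i) ` W" "\<phi> v" using \<phi>(2) by blast
      then have "\<kappa> v = 2" using e(2) by blast
      then show False using \<open>\<phi> v\<close> by (simp add: \<kappa>_def)
    qed
  qed
  moreover have "finite \<A>" "finite \<B>"
    unfolding \<A>_def \<B>_def using finite_solution_edges V W by auto
  moreover have "card e = card V" if "e \<in> \<A>" for e
    using that solution_edgesD(1)[of e A V n] V(1) by (simp add: \<A>_def)
  moreover have "card e = card W" if "e \<in> \<B>" for e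
    using that solution_edgesD(1)[of e B W n] W(1) by (simp add: \<B>_def)
  ultimately obtain es where es: "es \<in> dense_lists (\<A> \<union> \<B>)"
    using not_colourable_dense[of \<A> \<B> "card V" "card W"] V(2) W(2) by auto
  have "\<Union>(set es) \<subseteq> S" using dense_lists_sets[OF es] by (auto simp: \<A>_def \<B>_def)
  moreover have "\<A> \<union> \<B> \<subseteq> solution_edges A V n \<union> solution_edges B W n"
    by (auto simp: \<A>_def \<B>_def)
  ultimately show ?thesis using es dense_lists_mono by blast
qed

lemma weighted_degree:
  assumes W: "W \<subseteq> {..<dim_col (fst A)}" and n: "1 \<le> n"
    and Q: "0 \<le> Q" "Q \<le> c * real n powr (- \<theta>)"
    and S: "finite S" "card S \<le> card W"
    and x: "\<And>R. R \<subseteq> W \<Longrightarrow> card R = card S \<Longrightarrow>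
      real (proj_dim (fst A) W) - real (proj_dim (fst A) R) \<le> \<theta> * (real (card W) - real (card S)) + x"
  shows "(\<Sum>f\<in>{f\<in>solution_edges A W n. S \<subseteq> f}. Q ^ (card f - card S))
    \<le> real (card W) ^ card S * c ^ (card W - card S) * real n powr x"
proof -
  let ?t = "\<theta> * (real (card W) - real (card S)) + x"
  have finW: "finite W" using W finite_subset by blast
  have mono: "proj_dim (fst A) R \<le> proj_dim (fst A) W" if "R \<subseteq> W" for R
    using that W by (rule proj_dim_mono)
  obtain R where "R \<subseteq> W" "card R = card S" using S(2) obtain_subset_with_card_n by metis
  then have t: "0 \<le> ?t" using x[of R] mono[of R] by linarith
  \<comment> \<open>The difference of dimensions is a natural number, hence at most the integer part of its real bound.\<close>
  define D where "D = nat \<lfloor>?t\<rfloor>"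
  have D: "real D \<le> ?t" using t by (simp add: D_def)
  have "proj_dim (fst A) W - proj_dim (fst A) R \<le> D" if "R \<subseteq> W" "card R = card S" for R
    using x[OF that] mono[OF that(1)] unfolding D_def by (simp add: le_nat_floor of_nat_diff)
  then have "card {f\<in>solution_edges A W n. S \<subseteq> f} \<le> card W ^ card S * n ^ D"
    using W S n by (intro card_solution_edges_containing) auto
  then have "real (card {f\<in>solution_edges A W n. S \<subseteq> f}) \<le> real (card W ^ card S * n ^ D)"
    by (rule of_nat_mono)
  also have "\<dots> = real (card W) ^ card S * real n powr real D"
    using n by (simp add: powr_realpow)
  also have "\<dots> \<le> real (card W) ^ card S * real n powr ?t"
    using n D by (intro mult_left_mono powr_mono) auto
  finally have count: "real (card {f\<in>solution_edges A W n. S \<subseteq> f}) \<le> real (card W) ^ card S * real n powr ?t" .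
  have "(\<Sum>f\<in>{f\<in>solution_edges A W n. S \<subseteq> f}. Q ^ (card f - card S))
      = (\<Sum>f\<in>{f\<in>solution_edges A W n. S \<subseteq> f}. Q ^ (card W - card S))"
    using solution_edgesD(1)[OF _ W] by (intro sum.cong) auto
  also have "\<dots> = real (card {f\<in>solution_edges A W n. S \<subseteq> f}) * Q ^ (card W - card S)" by simp
  also have "\<dots> \<le> (real (card W) ^ card S * real n powr ?t) * (c * real n powr (- \<theta>)) ^ (card W - card S)"
    using count Q by (intro mult_mono power_mono) auto
  also have "(c * real n powr (- \<theta>)) ^ (card W - card S)
      = c ^ (card W - card S) * real n powr (- \<theta> * (real (card W) - real (card S)))"
    using n S(2) by (simp add: power_mult_distrib powr_power of_nat_diff mult.commute)
  also have "(real (card W) ^ card S * real n powr ?t) *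
      (c ^ (card W - card S) * real n powr (- \<theta> * (real (card W) - real (card S))))
      = real (card W) ^ card S * c ^ (card W - card S)
         * (real n powr ?t * real n powr (- \<theta> * (real (card W) - real (card S))))"
    by (simp only: mult_ac)
  also have "real n powr ?t * real n powr (- \<theta> * (real (card W) - real (card S))) = real n powr x"
    by (simp flip: powr_add)
  finally show ?thesis .
qed

text \<open>The number \<open>|R| - proj_dim M R\<close> of independent equations among the coordinates in \<open>R\<close> is \<open>\<mu> (|R| - 1)\<close> for
  \<open>R = W\<close>, and smaller for proper subsets \<open>R\<close> with at least two elements. If \<open>m_single M = 1 / (1 - \<mu>)\<close>,
  the minimal sets at which this maximum is attained have this property.\<close>

definition balanced :: "real \<Rightarrow> int mat \<Rightarrow> nat set \<Rightarrow> bool" where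
  "balanced \<mu> M W \<longleftrightarrow> W \<subseteq> {..<dim_col M} \<and> 3 \<le> card W \<and>
     real (proj_dim M W) = real (card W) - \<mu> * (real (card W) - 1) \<and>
     (\<forall>R\<subseteq>W. card R \<le> 2 \<longrightarrow> proj_dim M R = card R) \<and>
     (\<forall>R\<subset>W. 2 \<le> card R \<longrightarrow> real (card R) - real (proj_dim M R) < \<mu> * (real (card R) - 1))"

lemma balanced_gap:
  assumes "balanced \<mu> M W"
  obtains \<delta> where "0 < \<delta>"
    "\<forall>R\<subset>W. 2 \<le> card R \<longrightarrow> real (card R) - real (proj_dim M R) + \<delta> \<le> \<mu> * (real (card R) - 1)"
proof -
  let ?g = "\<lambda>R. \<mu> * (real (card R) - 1) - (real (card R) - real (proj_dim M R))"
  let ?X = "?g ` {R. R \<subset> W \<and> 2 \<le> card R}"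
  have "W \<subseteq> {..<dim_col M}" using assms by (simp add: balanced_def)
  then have "finite W" by (rule finite_subset) simp
  then have "finite {R. R \<subset> W \<and> 2 \<le> card R}" by (auto intro: finite_subset[of _ "Pow W"])
  then have fin: "finite ?X" by (rule finite_imageI)
  have lt: "\<forall>R\<subset>W. 2 \<le> card R \<longrightarrow> real (card R) - real (proj_dim M R) < \<mu> * (real (card R) - 1)"
    using assms unfolding balanced_def by (elim conjE)
  have pos: "0 < y" if "y \<in> ?X" for y
  proof -
    obtain R where R: "y = ?g R" "R \<subset> W" "2 \<le> card R" using \<open>y \<in> ?X\<close> by blast
    have "real (card R) - real (proj_dim M R) < \<mu> * (real (card R) - 1)" using lt R(2,3) by blast
    then show ?thesis unfolding R(1) by simp
  qed
  define \<delta> where "\<delta> = Min (insert 1 ?X)"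
  have "0 < \<delta>" unfolding \<delta>_def using fin pos by (subst Min_gr_iff) auto
  moreover have "\<delta> \<le> ?g R" if "R \<subset> W" "2 \<le> card R" for R
    unfolding \<delta>_def using fin that by (intro Min_le) auto
  then have "\<forall>R\<subset>W. 2 \<le> card R \<longrightarrow> real (card R) - real (proj_dim M R) + \<delta> \<le> \<mu> * (real (card R) - 1)"
    by (simp add: le_diff_eq add.commute)
  ultimately show ?thesis by (intro that[of \<delta>])
qed

text \<open>The ratio of consecutive terms is at most one half, and the first one is \<open>9 / 64\<close>. The bound is
  uniform in \<open>k\<close>, which makes the constant of the theorem independent of the size of the edges.\<close>

lemma small_power_bound:
  assumes "3 \<le> k"
  shows "real k * (real k * (1 / 8) ^ (k - 1)) \<le> 1 / 4"
  using assms
proof (induction k rule: dec_induct)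
  case base
  show ?case by (simp add: power2_eq_square)
next
  case (step k)
  have "real (Suc k) \<le> 2 * real k" using step by simp
  then have "real (Suc k) * real (Suc k) \<le> (2 * real k) * (2 * real k)" by (intro mult_mono) auto
  then have "real (Suc k) * real (Suc k) * (1 / 8) ^ k \<le> (2 * real k) * (2 * real k) * (1 / 8) ^ k"
    by (intro mult_right_mono) auto
  also have "\<dots> = 1 / 2 * (real k * (real k * (1 / 8) ^ (k - 1)))"
    using step power_Suc[of "1/8::real" "k - 1"] by simp
  also have "\<dots> \<le> 1 / 4" using step by simp
  finally show ?case by (simp add: mult.assoc)
qed

text \<open>All four bounds are instances of the inequality \<open>deg\<close> in the proof, in which the exponent of \<open>n\<close> is
  \<open>|R| - proj_dim M R - \<mu> (|R| - 1)\<close> for the worst set \<open>R\<close> of positions of the elements of \<open>S\<close>.\<close>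

lemma balanced_degrees:
  assumes bal: "balanced \<mu> (fst A) W"
    and gap: "\<forall>R\<subset>W. 2 \<le> card R \<longrightarrow>
      real (card R) - real (proj_dim (fst A) R) + \<delta> \<le> \<mu> * (real (card R) - 1)"
    and n: "1 \<le> n" and Q: "0 \<le> Q" "Q \<le> 1 / 8 * real n powr (- (1 - \<mu>))"
  defines "E \<equiv> solution_edges A W n" and "k \<equiv> card W"
  shows "(\<Sum>e\<in>E. real (card e) * Q ^ card e) \<le> real k * real n powr \<mu>"
    and "(\<Sum>f\<in>{f\<in>E. {v} \<subset> f}. real (card f) * Q ^ (card f - 1)) \<le> 1 / 4"
    and "card S = 2 \<Longrightarrow> (\<Sum>f\<in>{f\<in>E. S \<subset> f}. Q ^ (card f - card S)) \<le> real k ^ 2 * real n powr (- \<mu>)"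
    and "2 \<le> card S \<Longrightarrow> (\<Sum>f\<in>{f\<in>E. S \<subset> f}. Q ^ (card f - card S)) \<le> real k ^ k * real n powr (- \<delta>)"
proof -
  have W: "W \<subseteq> {..<dim_col (fst A)}" and k: "3 \<le> k" using bal by (auto simp: balanced_def k_def)
  have finE: "finite E" unfolding E_def by (rule finite_solution_edges[OF W])
  have cardE: "card f = k" if "f \<in> E" for f using that solution_edgesD(1)[OF _ W] by (simp add: E_def k_def)
  have pW: "real (proj_dim (fst A) W) = real k - \<mu> * (real k - 1)" using bal by (simp add: balanced_def k_def)
  have small: "proj_dim (fst A) R = card R" if "R \<subseteq> W" "card R \<le> 2" for R
    using bal that by (simp add: balanced_def)
  have deg: "(\<Sum>f\<in>{f\<in>E. S \<subset> f}. Q ^ (card f - card S)) \<le> real k ^ card S * (1 / 8) ^ (k - card S) * real n powr x"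
    if S: "finite S" "card S \<le> k"
      and x: "\<And>R. R \<subseteq> W \<Longrightarrow> card R = card S \<Longrightarrow> real (card R) - \<mu> * (real (card R) - 1) - real (proj_dim (fst A) R) \<le> x"
    for S x
  proof -
    have "(\<Sum>f\<in>{f\<in>E. S \<subset> f}. Q ^ (card f - card S)) \<le> (\<Sum>f\<in>{f\<in>E. S \<subseteq> f}. Q ^ (card f - card S))"
      using finE Q by (intro sum_mono2) auto
    also have "\<dots> \<le> real k ^ card S * (1 / 8) ^ (k - card S) * real n powr x"
      unfolding E_def k_def
    proof (rule weighted_degree[OF W n Q S(1)])
      show "card S \<le> card W" using S k_def by simp
      fix R assume R: "R \<subseteq> W" "card R = card S"
      have "real k - \<mu> * (real k - 1) - real (proj_dim (fst A) R)
          = (1 - \<mu>) * (real k - real (card R)) +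
            (real (card R) - \<mu> * (real (card R) - 1) - real (proj_dim (fst A) R))"
        by (simp add: algebra_simps)
      then show "real (proj_dim (fst A) W) - real (proj_dim (fst A) R)
          \<le> (1 - \<mu>) * (real (card W) - real (card S)) + x"
        using x[OF R] pW R(2) by (simp add: k_def)
    qed
    finally show ?thesis .
  qed
  have le1: "(1 / 8 :: real) ^ m \<le> 1" for m by (simp add: power_le_one)
  show "(\<Sum>e\<in>E. real (card e) * Q ^ card e) \<le> real k * real n powr \<mu>"
  proof -
    have "{} \<subset> e" if "e \<in> E" for e using cardE[OF that] k by auto
    then have "{f\<in>E. {} \<subset> f} = E" by blast
    moreover have "(\<Sum>f\<in>{f\<in>E. {} \<subset> f}. Q ^ (card f - card ({}::int set))) \<le> real k ^ card ({}::int set) * (1 / 8) ^ (k - card ({}::int set)) * real n powr \<mu>"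
      by (rule deg) auto
    ultimately have "(\<Sum>e\<in>E. Q ^ card e) \<le> (1 / 8) ^ k * real n powr \<mu>" by simp
    also have "\<dots> \<le> 1 * real n powr \<mu>" using le1 by (intro mult_right_mono) auto
    finally have "real k * (\<Sum>e\<in>E. Q ^ card e) \<le> real k * real n powr \<mu>"
      by (intro mult_left_mono) auto
    then show ?thesis using cardE by (simp add: mult_ac)
  qed
  show "(\<Sum>f\<in>{f\<in>E. {v} \<subset> f}. real (card f) * Q ^ (card f - 1)) \<le> 1 / 4"
  proof -
    have "(\<Sum>f\<in>{f\<in>E. {v} \<subset> f}. Q ^ (card f - card {v})) \<le> real k ^ card {v} * (1 / 8) ^ (k - card {v}) * real n powr 0"
      by (rule deg) (use k small in auto)
    then have "(\<Sum>f\<in>{f\<in>E. {v} \<subset> f}. Q ^ (card f - 1)) \<le> real k * (1 / 8) ^ (k - 1)" using n by simp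
    then have "real k * (\<Sum>f\<in>{f\<in>E. {v} \<subset> f}. Q ^ (card f - 1)) \<le> real k * (real k * (1 / 8) ^ (k - 1))"
      by (intro mult_left_mono) auto
    also have "\<dots> \<le> 1 / 4" by (rule small_power_bound[OF k])
    finally show ?thesis using cardE by (simp add: mult_ac)
  qed
  show "(\<Sum>f\<in>{f\<in>E. S \<subset> f}. Q ^ (card f - card S)) \<le> real k ^ 2 * real n powr (- \<mu>)" if S: "card S = 2"
  proof -
    have "finite S" using S by (intro card_ge_0_finite) auto
    then have "(\<Sum>f\<in>{f\<in>E. S \<subset> f}. Q ^ (card f - card S)) \<le> real k ^ card S * (1 / 8) ^ (k - card S) * real n powr (- \<mu>)"
      by (rule deg) (use k S small in auto)
    also have "\<dots> \<le> real k ^ card S * 1 * real n powr (- \<mu>)"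
      using le1 by (intro mult_right_mono mult_left_mono) auto
    finally show ?thesis using S by simp
  qed
  show "(\<Sum>f\<in>{f\<in>E. S \<subset> f}. Q ^ (card f - card S)) \<le> real k ^ k * real n powr (- \<delta>)" if S: "2 \<le> card S"
  proof (cases "card S < k")
    case True
    have "finite S" using S by (intro card_ge_0_finite) auto
    then have "(\<Sum>f\<in>{f\<in>E. S \<subset> f}. Q ^ (card f - card S)) \<le> real k ^ card S * (1 / 8) ^ (k - card S) * real n powr (- \<delta>)"
    proof (rule deg)
      fix R assume R: "R \<subseteq> W" "card R = card S"
      have "R \<subset> W" using True R by (auto simp: k_def)
      moreover have "2 \<le> card R" using R S by simp
      ultimately have gap_R: "real (card R) - real (proj_dim (fst A) R) + \<delta> \<le> \<mu> * (real (card R) - 1)"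
        using gap by blast
      show "real (card R) - \<mu> * (real (card R) - 1) - real (proj_dim (fst A) R) \<le> - \<delta>"
        using gap_R R(2) by linarith
    qed (use True in simp)
    also have "\<dots> \<le> real k ^ k * 1 * real n powr (- \<delta>)"
      using le1 True k by (intro mult_right_mono mult_mono power_increasing) auto
    finally show ?thesis by simp
  next
    case False
    have "\<not> S \<subset> f" if "f \<in> E" for f
    proof
      assume "S \<subset> f"
      moreover have "finite f" using cardE[OF that] k by (intro card_ge_0_finite) auto
      ultimately have "card S < card f" by (rule psubset_card_mono[rotated])
      then show False using False cardE[OF that] by simp
    qed
    then have "{f\<in>E. S \<subset> f} = {}" by blast
    then have "(\<Sum>f\<in>{f\<in>E. S \<subset> f}. Q ^ (card f - card S)) = 0" by (simp only: sum.empty)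
    then show ?thesis by simp
  qed
qed

lemma sum_filter_Un_le:
  fixes g :: "'a \<Rightarrow> real"
  assumes "finite X" "finite Y" "\<And>f. 0 \<le> g f"
  shows "sum g {f\<in>X \<union> Y. P f} \<le> sum g {f\<in>X. P f} + sum g {f\<in>Y. P f}"
proof -
  have "{f\<in>X \<union> Y. P f} = {f\<in>X. P f} \<union> {f\<in>Y. P f}" by blast
  then have "sum g {f\<in>X \<union> Y. P f} + sum g ({f\<in>X. P f} \<inter> {f\<in>Y. P f}) = sum g {f\<in>X. P f} + sum g {f\<in>Y. P f}"
    using assms by (simp add: sum.union_inter)
  moreover have "0 \<le> sum g ({f\<in>X. P f} \<inter> {f\<in>Y. P f})" using assms by (intro sum_nonneg) auto
  ultimately show ?thesis by linarith
qed

text \<open>The powers of \<open>n\<close> for the first edge and for the overlap in two vertices cancel, and what remains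
  is the gap \<open>\<delta>\<close> of the further overlap.\<close>

lemma prob_rado_le:
  assumes balA: "balanced \<mu> (fst A) V" and balB: "balanced \<mu> (fst B) W"
    and gapA: "\<forall>R\<subset>V. 2 \<le> card R \<longrightarrow>
      real (card R) - real (proj_dim (fst A) R) + \<delta> \<le> \<mu> * (real (card R) - 1)"
    and gapB: "\<forall>R\<subset>W. 2 \<le> card R \<longrightarrow>
      real (card R) - real (proj_dim (fst B) R) + \<delta> \<le> \<mu> * (real (card R) - 1)"
    and n: "1 \<le> n" and p: "0 \<le> p" "p \<le> 1" "p \<le> 1 / 64 * real n powr (- (1 - \<mu>))"
  defines "a \<equiv> real (card V)" and "b \<equiv> real (card W)"
  shows "measure_pmf.prob (random_subset n p) {S. rado A B S}
    \<le> 6 * (a\<^sup>2 + b\<^sup>2) * (a ^ card V + b ^ card W) * (a + b) * real n powr (- \<delta>)"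
proof -
  define EA where "EA = solution_edges A V n"
  define EB where "EB = solution_edges B W n"
  define H where "H = EA \<union> EB"
  have V: "V \<subseteq> {..<dim_col (fst A)}" "3 \<le> card V" and W: "W \<subseteq> {..<dim_col (fst B)}" "3 \<le> card W"
    using balA balB by (auto simp: balanced_def)
  have fin: "finite EA" "finite EB" unfolding EA_def EB_def using V W finite_solution_edges by auto
  have Q: "0 \<le> 8 * p" "8 * p \<le> 1 / 8 * real n powr (- (1 - \<mu>))" using p by auto
  note dA = balanced_degrees[OF balA gapA n Q, folded EA_def a_def]
  note dB = balanced_degrees[OF balB gapB n Q, folded EB_def b_def]
  define \<epsilon>2 where "\<epsilon>2 = (a\<^sup>2 + b\<^sup>2) * real n powr (- \<mu>)"
  define \<epsilon>3 where "\<epsilon>3 = (a ^ card V + b ^ card W) * real n powr (- \<delta>)"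
  have ab: "0 \<le> a" "0 \<le> b" by (auto simp: a_def b_def)
  interpret sparse_edges H "8 * p" \<epsilon>2 \<epsilon>3
  proof
    show "finite H" using fin by (simp add: H_def)
    show "2 \<le> card e" if "e \<in> H" for e
      using that solution_edgesD(1)[OF _ V(1)] solution_edgesD(1)[OF _ W(1)] V(2) W(2)
      by (auto simp: H_def EA_def EB_def)
    show "0 \<le> 8 * p" by fact
    show "0 \<le> \<epsilon>2" "0 \<le> \<epsilon>3" using ab by (auto simp: \<epsilon>2_def \<epsilon>3_def)
    show "(\<Sum>f\<in>{f\<in>H. {v} \<subset> f}. real (card f) * (8 * p) ^ (card f - 1)) \<le> 1 / 2" for v
      unfolding H_def
      by (rule order.trans[OF sum_filter_Un_le[OF fin]]) (use Q dA(2)[of v] dB(2)[of v] in simp_all)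
    show "(\<Sum>f\<in>{f\<in>H. S \<subset> f}. (8 * p) ^ (card f - card S)) \<le> \<epsilon>2" if "card S = 2" for S
      unfolding H_def \<epsilon>2_def
      by (rule order.trans[OF sum_filter_Un_le[OF fin]])
        (use Q dA(3)[OF that] dB(3)[OF that] in \<open>simp_all add: distrib_right\<close>)
    show "(\<Sum>f\<in>{f\<in>H. S \<subset> f}. (8 * p) ^ (card f - card S)) \<le> \<epsilon>3" if "2 \<le> card S" for S
      unfolding H_def \<epsilon>3_def
      by (rule order.trans[OF sum_filter_Un_le[OF fin]])
        (use Q dA(4)[OF that] dB(4)[OF that] in \<open>simp_all add: distrib_right\<close>)
  qed
  have E0: "E\<^sub>0 \<le> (a + b) * real n powr \<mu>"
  proof -
    have "H = {e\<in>EA \<union> EB. True}" by (auto simp: H_def)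
    then have "E\<^sub>0 = (\<Sum>e\<in>{e\<in>EA \<union> EB. True}. real (card e) * (8 * p) ^ card e)"
      unfolding E\<^sub>0_def by (rule arg_cong)
    also have "\<dots> \<le> (\<Sum>e\<in>{e\<in>EA. True}. real (card e) * (8 * p) ^ card e)
        + (\<Sum>e\<in>{e\<in>EB. True}. real (card e) * (8 * p) ^ card e)"
      by (rule sum_filter_Un_le[OF fin]) (use Q in simp)
    also have "\<dots> \<le> (a + b) * real n powr \<mu>" using dA(1) dB(1) by (simp add: distrib_right)
    finally show ?thesis .
  qed
  have "measure_pmf.prob (random_subset n p) {S. rado A B S}
      \<le> measure_pmf.prob (random_subset n p) {S. \<exists>es\<in>dense_lists H. \<Union>(set es) \<subseteq> S}"
  proof (rule measure_pmf.finite_measure_mono_AE)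
    show "AE S in measure_pmf (random_subset n p). S \<in> {S. rado A B S} \<longrightarrow>
        S \<in> {S. \<exists>es\<in>dense_lists H. \<Union>(set es) \<subseteq> S}"
      using rado_dense[OF set_pmf_random_subset _ V W] by (auto simp: AE_measure_pmf_iff H_def EA_def EB_def)
  qed simp
  also have "\<dots> \<le> (\<Sum>es\<in>dense_lists H. p ^ card (\<Union>(set es)))"
  proof (rule prob_random_subset_list_le[OF p(1,2)])
    show "finite (dense_lists H)" using weight_dense(1)[of p] p by simp
    have H: "e \<subseteq> {1..int n}" if "e \<in> H" for e
      using that solution_edgesD(2)[of e A V n, OF _ V(1)] solution_edgesD(2)[of e B W n, OF _ W(1)]
      unfolding H_def EA_def EB_def by (elim UnE) simp_all
    show "\<Union>(set es) \<subseteq> {1..int n}" if "es \<in> dense_lists H" for es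
      using dense_lists_sets[OF that] H by blast
  qed
  also have "\<dots> \<le> 6 * \<epsilon>2 * \<epsilon>3 * E\<^sub>0" using weight_dense(2)[of p] p by simp
  also have "\<dots> \<le> 6 * \<epsilon>2 * \<epsilon>3 * ((a + b) * real n powr \<mu>)"
    using E0 eps by (intro mult_left_mono) auto
  also have "\<dots> = 6 * (a\<^sup>2 + b\<^sup>2) * (a ^ card V + b ^ card W) * (a + b) * real n powr (- \<delta>)
      * (real n powr (- \<mu>) * real n powr \<mu>)"
    by (simp only: \<epsilon>2_def \<epsilon>3_def mult_ac)
  also have "real n powr (- \<mu>) * real n powr \<mu> = 1" using n by (simp flip: powr_add)
  finally show ?thesis by simp
qed

lemma prob_rado_tendsto_0:
  assumes "balanced \<mu> (fst A) V" "balanced \<mu> (fst B) W"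
    and p: "\<And>n. 1 \<le> n \<Longrightarrow> 0 \<le> p n \<and> p n \<le> 1 \<and> p n \<le> 1 / 64 * real n powr (- (1 - \<mu>))"
  shows "(\<lambda>n. measure_pmf.prob (random_subset n (p n)) {S. rado A B S}) \<longlonglongrightarrow> 0"
proof -
  obtain \<delta>A where A: "0 < \<delta>A" "\<forall>R\<subset>V. 2 \<le> card R \<longrightarrow>
      real (card R) - real (proj_dim (fst A) R) + \<delta>A \<le> \<mu> * (real (card R) - 1)"
    by (rule balanced_gap[OF assms(1)])
  obtain \<delta>B where B: "0 < \<delta>B" "\<forall>R\<subset>W. 2 \<le> card R \<longrightarrow>
      real (card R) - real (proj_dim (fst B) R) + \<delta>B \<le> \<mu> * (real (card R) - 1)"
    by (rule balanced_gap[OF assms(2)])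
  define \<delta> where "\<delta> = min \<delta>A \<delta>B"
  have \<delta>: "0 < \<delta>" using A B by (simp add: \<delta>_def)
  define C where "C = 6 * ((real (card V))\<^sup>2 + (real (card W))\<^sup>2)
    * (real (card V) ^ card V + real (card W) ^ card W) * (real (card V) + real (card W))"
  have bound: "measure_pmf.prob (random_subset n (p n)) {S. rado A B S} \<le> C * real n powr (- \<delta>)" if "1 \<le> n" for n
    unfolding C_def
  proof (rule prob_rado_le[OF assms(1,2) _ _ that])
    show "\<forall>R\<subset>V. 2 \<le> card R \<longrightarrow> real (card R) - real (proj_dim (fst A) R) + \<delta> \<le> \<mu> * (real (card R) - 1)"
      proof (intro allI impI)
      fix R assume "R \<subset> V" "2 \<le> card R"
      then have "real (card R) - real (proj_dim (fst A) R) + \<delta>A \<le> \<mu> * (real (card R) - 1)"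
        using A(2) by blast
      then show "real (card R) - real (proj_dim (fst A) R) + \<delta> \<le> \<mu> * (real (card R) - 1)"
        by (simp add: \<delta>_def)
    qed
    show "\<forall>R\<subset>W. 2 \<le> card R \<longrightarrow> real (card R) - real (proj_dim (fst B) R) + \<delta> \<le> \<mu> * (real (card R) - 1)"
      proof (intro allI impI)
      fix R assume "R \<subset> W" "2 \<le> card R"
      then have "real (card R) - real (proj_dim (fst B) R) + \<delta>B \<le> \<mu> * (real (card R) - 1)"
        using B(2) by blast
      then show "real (card R) - real (proj_dim (fst B) R) + \<delta> \<le> \<mu> * (real (card R) - 1)"
        by (simp add: \<delta>_def)
    qed
  qed (use p[OF that] in auto)
  have ev: "\<forall>\<^sub>F n in sequentially. measure_pmf.prob (random_subset n (p n)) {S. rado A B S} \<le> C * real n powr (- \<delta>)"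
    by (rule eventually_mono[OF eventually_ge_at_top[of "1::nat"]]) (rule bound)
  have lim: "(\<lambda>n. C * real n powr (- \<delta>)) \<longlonglongrightarrow> 0"
    using tendsto_mult_left[OF tendsto_neg_powr[OF _ filterlim_real_sequentially, of "- \<delta>"], of C] \<delta> by simp
  show ?thesis
    by (rule tendsto_sandwich[OF always_eventually ev tendsto_const lim]) simp
qed


section \<open>The densities of the systems\<close>

lemma rank_quotient:
  assumes "W \<subseteq> {..<dim_col M}"
  shows "real (card W) - 1 + real (mat_rank (restrict_compl M W)) - real (mat_rank M)
    = real (proj_dim M W) - 1"
  using proj_dim_add[OF assms] unfolding mat_rank_restrict_compl mat_rank_eq_col_rank[of M] by linarith

lemma m_single_eq:
  "m_single M = Max ((\<lambda>W. (real (card W) - 1) / (real (proj_dim M W) - 1))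
     ` {W. W \<subseteq> {..<dim_col M} \<and> 2 \<le> card W})"
  unfolding m_single_def by (intro arg_cong[where f = Max] image_cong refl) (simp add: rank_quotient)

lemma m_pair_eq:
  "m_pair M N = Max ((\<lambda>W. real (card W) / (real (proj_dim M W) - 1 + 1 / m_single N))
     ` {W. W \<subseteq> {..<dim_col M} \<and> 2 \<le> card W})"
  unfolding m_pair_def by (intro arg_cong[where f = Max] image_cong refl) (simp add: rank_quotient)

lemma finite_index_sets: "finite {W. W \<subseteq> {..<q::nat} \<and> 2 \<le> card W}"
  by (rule finite_subset[of _ "Pow {..<q}"]) auto

lemma m_single_strictly_balanced:
  assumes C: "C \<in> carrier_mat l k" and lk: "l + 2 \<le> k"
    and bal: "full_rank C" "strictly_balanced C"
  shows "m_single C = (real k - 1) / (real k - 1 - real l)"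
proof -
  let ?f = "\<lambda>W. (real (card W) - 1) /
       (real (card W) - 1 + real (mat_rank (restrict_compl C W)) - real (mat_rank C))"
  let ?X = "{W. W \<subseteq> {..<dim_col C} \<and> 2 \<le> card W}"
  have dims: "dim_row C = l" "dim_col C = k" using C by auto
  have rank: "mat_rank C = l" using bal(1) lk by (simp add: full_rank_def dims)
  have full: "?f {..<k} = (real k - 1) / (real k - 1 - real l)"
    using mat_rank_restrict_compl_all[of C] rank by (simp add: dims)
  have le: "?f W \<le> (real k - 1) / (real k - 1 - real l)" if W: "W \<in> ?X" for W
  proof (cases "W = {..<k}")
    case False
    then have "W \<subset> {..<k}" using W dims by auto
    then have "card W < k" using psubset_card_mono[of "{..<k}" W] by simp
    then have "(real (card W) - 1) / (real (card W) - 1 + real (mat_rank (restrict_compl C W)) - real l)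
        < (real k - 1) / (real k - 1 - real l)"
      using bal(2) W unfolding strictly_balanced_def dims by blast
    then show ?thesis unfolding rank by simp
  next
    case True
    then show ?thesis using full by (simp only: order.refl)
  qed
  have "{..<k} \<in> ?X" using lk dims by simp
  then have "(real k - 1) / (real k - 1 - real l) \<in> ?f ` ?X" unfolding full[symmetric] by (rule imageI)
  then show ?thesis unfolding m_single_def
    using finite_index_sets le by (intro Max_eqI) auto
qed

text \<open>As \<open>m_single M = 1 / (1 - \<mu>)\<close>, the inequality says that no set \<open>W\<close> exceeds the maximum. Among the sets that attain it,
  one of smallest size is balanced; sets of size 2 do not attain it since their \<open>proj_dim\<close> is 2.\<close>

lemma exists_balanced:
  assumes M: "irredundant M" "partition_regular M" "2 \<le> dim_col M"
    and m: "m_single M = 1 / (1 - \<mu>)" and \<mu>: "0 < \<mu>" "\<mu> < 1"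
  shows "\<And>W. W \<subseteq> {..<dim_col M} \<Longrightarrow> 2 \<le> card W \<Longrightarrow>
      real (card W) - real (proj_dim M W) \<le> \<mu> * (real (card W) - 1)"
    and "\<exists>W. balanced \<mu> M W"
proof -
  let ?X = "{W. W \<subseteq> {..<dim_col M} \<and> 2 \<le> card W}"
  let ?f = "\<lambda>W. (real (card W) - 1) / (real (proj_dim M W) - 1)"
  have fin: "finite (?f ` ?X)" using finite_index_sets by (rule finite_imageI)
  have pos: "0 < real (proj_dim M W) - 1" if "W \<subseteq> {..<dim_col M}" "2 \<le> card W" for W
    using proj_dim_ge_2[OF M(1,2) that] by simp
  show le: "real (card W) - real (proj_dim M W) \<le> \<mu> * (real (card W) - 1)"
    if W: "W \<subseteq> {..<dim_col M}" "2 \<le> card W" for W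
  proof -
    have "?f W \<le> 1 / (1 - \<mu>)" unfolding m[symmetric] m_single_eq using fin W by (intro Max_ge) auto
    then have "(real (card W) - 1) * (1 - \<mu>) \<le> real (proj_dim M W) - 1"
      using pos[OF W] \<mu> by (simp add: divide_simps)
    then show ?thesis by (simp add: algebra_simps)
  qed
  define tight where "tight W \<longleftrightarrow> W \<subseteq> {..<dim_col M} \<and> 2 \<le> card W \<and>
    real (card W) - real (proj_dim M W) = \<mu> * (real (card W) - 1)" for W
  have "{..<dim_col M} \<in> ?X" using M(3) by simp
  then have "?f ` ?X \<noteq> {}" by blast
  then have "m_single M \<in> ?f ` ?X" unfolding m_single_eq using fin by (intro Max_in)
  then obtain W0 where W0: "W0 \<subseteq> {..<dim_col M}" "2 \<le> card W0" "?f W0 = 1 / (1 - \<mu>)"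
    unfolding m by (auto simp: eq_commute)
  then have "(real (card W0) - 1) * (1 - \<mu>) = real (proj_dim M W0) - 1"
    using pos[OF W0(1,2)] \<mu> by (simp add: divide_simps)
  then have "tight W0" using W0 by (simp add: tight_def algebra_simps)
  then obtain W where W: "tight W" "\<And>R. tight R \<Longrightarrow> card W \<le> card R"
    using ex_has_least_nat[of tight W0 card] by blast
  have sub: "W \<subseteq> {..<dim_col M}" and W2: "2 \<le> card W"
    and eq: "real (card W) - real (proj_dim M W) = \<mu> * (real (card W) - 1)"
    using W(1) by (auto simp: tight_def)
  have finW: "finite W" using sub by (rule finite_subset) simp
  have small: "proj_dim M R = card R" if R: "R \<subseteq> {..<dim_col M}" "card R \<le> 2" for R
  proof -
    have finR: "finite R" using R(1) by (rule finite_subset) simp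
    consider "card R = 0" | "card R = 1" | "card R = 2" using R(2) by linarith
    then show ?thesis
    proof cases
      case 1
      then show ?thesis using finR by (simp add: proj_dim_empty)
    next
      case 2
      then obtain i where i: "R = {i}" by (rule card_1_singletonE)
      define j where "j = (if i = 0 then 1 else 0 :: nat)"
      have "j < dim_col M" "i \<noteq> j" using M(3) by (auto simp: j_def)
      moreover have "i < dim_col M" using i R(1) by simp
      ultimately show ?thesis using proj_dim_small(1)[OF M(1,2), of i j] i by simp
    next
      case 3
      then obtain i j where "R = {i, j}" "i \<noteq> j" by (auto simp: card_2_iff)
      then show ?thesis using proj_dim_small(2)[OF M(1,2), of i j] R(1) by simp
    qed
  qed
  have "card W \<noteq> 2"
  proof
    assume "card W = 2"
    then show False using small[OF sub] eq \<mu> by simp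
  qed
  then have "3 \<le> card W" using W2 by simp
  moreover have "real (card R) - real (proj_dim M R) < \<mu> * (real (card R) - 1)"
    if R: "R \<subset> W" "2 \<le> card R" for R
  proof -
    have Rs: "R \<subseteq> {..<dim_col M}" using R sub by blast
    have "card R < card W" using R finW by (intro psubset_card_mono)
    then have "\<not> tight R" using W(2)[of R] by auto
    then show ?thesis using le[OF Rs R(2)] Rs R(2) by (simp add: tight_def)
  qed
  moreover have "real (proj_dim M W) = real (card W) - \<mu> * (real (card W) - 1)" using eq by simp
  ultimately have "balanced \<mu> M W" unfolding balanced_def using sub small by auto
  then show "\<exists>W. balanced \<mu> M W" by blast
qed

text \<open>Adding 1 to \<open>|W| - 1\<close> and \<open>1 / m_single N = 1 - \<mu>\<close> to \<open>proj_dim M W - 1\<close> does not change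
  the bound \<open>1 / (1 - \<mu>)\<close> for the quotient, nor the case of equality.\<close>

lemma m_pair_balanced:
  assumes M: "irredundant M" "partition_regular M" "2 \<le> dim_col M"
    and m: "m_single M = 1 / (1 - \<mu>)" "m_single N = 1 / (1 - \<mu>)" and \<mu>: "0 < \<mu>" "\<mu> < 1"
  shows "m_pair M N = 1 / (1 - \<mu>)"
proof -
  let ?X = "{W. W \<subseteq> {..<dim_col M} \<and> 2 \<le> card W}"
  let ?f = "\<lambda>W. real (card W) / (real (proj_dim M W) - 1 + 1 / m_single N)"
  have fin: "finite (?f ` ?X)" using finite_index_sets by (rule finite_imageI)
  have N: "1 / m_single N = 1 - \<mu>" using m(2) by simp
  have le: "?f W \<le> 1 / (1 - \<mu>)" if "W \<in> ?X" for W
  proof -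
    have W: "W \<subseteq> {..<dim_col M}" "2 \<le> card W" using that by auto
    have "real (card W) * (1 - \<mu>) \<le> real (proj_dim M W) - 1 + (1 - \<mu>)"
      using exists_balanced(1)[OF M m(1) \<mu> W] by (simp add: algebra_simps)
    moreover have "0 < real (card W) * (1 - \<mu>)" using W \<mu> by simp
    ultimately show ?thesis unfolding N using \<mu> by (simp add: divide_simps)
  qed
  obtain W where W: "balanced \<mu> M W" using exists_balanced(2)[OF M m(1) \<mu>] by blast
  then have WX: "W \<in> ?X" and pW: "real (proj_dim M W) = real (card W) - \<mu> * (real (card W) - 1)"
    and cW: "3 \<le> card W"
    unfolding balanced_def by auto
  have "real (proj_dim M W) - 1 + (1 - \<mu>) = real (card W) * (1 - \<mu>)"
    unfolding pW by (simp add: algebra_simps)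
  then have "?f W = 1 / (1 - \<mu>)" unfolding N using cW \<mu> by simp
  from this[symmetric] have "1 / (1 - \<mu>) \<in> ?f ` ?X" using WX by (rule image_eqI)
  then show ?thesis unfolding m_pair_eq using fin le by (intro Max_eqI) auto
qed

lemma core_m_single:
  assumes "is_core M C" "C \<in> carrier_mat l k" "l + 2 \<le> k"
  shows "m_single M = (real k - 1) / (real k - 1 - real l)" "k \<le> dim_col M"
proof -
  obtain I J where IJ: "J \<subseteq> {..<dim_col M}" "C = submatrix M I J"
    and C: "m_single C = m_single M" "full_rank C" "strictly_balanced C"
    using assms(1) unfolding is_core_def by blast
  show "m_single M = (real k - 1) / (real k - 1 - real l)"
    using m_single_strictly_balanced[OF assms(2,3) C(2,3)] C(1) by simp
  have "k = card {j. j < dim_col M \<and> j \<in> J}" using assms(2) IJ(2) dim_submatrix(2)[of M I J] by auto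
  also have "\<dots> \<le> card {..<dim_col M}" by (intro card_mono) auto
  finally show "k \<le> dim_col M" by simp
qed

theorem theorem1p7:
  fixes k l :: nat
  assumes "1 \<le> k" and "1 \<le> l" and "l + 2 \<le> k"
  shows "\<exists>c>0. \<forall>(A :: lin_system) (B :: lin_system) (CA :: int mat) (CB :: int mat).
    linear_system A \<and> linear_system B \<and>
    irredundant (fst A) \<and> partition_regular (fst A) \<and> full_rank (fst A) \<and>
    irredundant (fst B) \<and> partition_regular (fst B) \<and> full_rank (fst B) \<and>
    is_core (fst A) CA \<and> CA \<in> carrier_mat l k \<and>
    is_core (fst B) CB \<and> CB \<in> carrier_mat l k \<longrightarrow>
      1 / m_pair (fst A) (fst B) = (real k - real l - 1) / (real k - 1) \<and>
      (\<forall>p :: nat \<Rightarrow> real.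
        (\<forall>n\<ge>1. 0 \<le> p n \<and> p n \<le> 1 \<and>
                p n \<le> c * real n powr (- 1 / m_pair (fst A) (fst B))) \<longrightarrow>
        (\<lambda>n. measure_pmf.prob (random_subset n (p n)) {S. rado A B S}) \<longlonglongrightarrow> 0)"
  \<comment> \<open>\<open>1 / 64 = 1 / 8 * 1 / 8\<close>: one factor for the eightfold probability in \<open>weight_dense\<close>, the other for
    \<open>small_power_bound\<close>.\<close>
proof (rule exI[of _ "1 / 64"], intro conjI allI impI)
  show "(0::real) < 1 / 64" by simp
next
  fix A B :: lin_system and CA CB :: "int mat"
  assume *: "linear_system A \<and> linear_system B \<and>
    irredundant (fst A) \<and> partition_regular (fst A) \<and> full_rank (fst A) \<and>
    irredundant (fst B) \<and> partition_regular (fst B) \<and> full_rank (fst B) \<and>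
    is_core (fst A) CA \<and> CA \<in> carrier_mat l k \<and>
    is_core (fst B) CB \<and> CB \<in> carrier_mat l k"
  then have A: "irredundant (fst A)" "partition_regular (fst A)" "is_core (fst A) CA" "CA \<in> carrier_mat l k"
    and B: "irredundant (fst B)" "partition_regular (fst B)" "is_core (fst B) CB" "CB \<in> carrier_mat l k"
    by simp_all
  define \<mu> where "\<mu> = real l / (real k - 1)"
  have \<mu>: "0 < \<mu>" "\<mu> < 1" using assms by (auto simp: \<mu>_def divide_simps)
  have one_minus: "1 - \<mu> = (real k - real l - 1) / (real k - 1)"
    using assms by (simp add: \<mu>_def field_simps)
  have inv: "(real k - 1) / (real k - 1 - real l) = 1 / (1 - \<mu>)"
    unfolding one_minus by (simp add: algebra_simps)
  note cA = core_m_single[OF A(3,4) assms(3), unfolded inv]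
  note cB = core_m_single[OF B(3,4) assms(3), unfolded inv]
  have dA: "2 \<le> dim_col (fst A)" and dB: "2 \<le> dim_col (fst B)" using cA(2) cB(2) assms by auto
  have pair: "m_pair (fst A) (fst B) = 1 / (1 - \<mu>)"
    by (rule m_pair_balanced[OF A(1,2) dA cA(1) cB(1) \<mu>])
  show "1 / m_pair (fst A) (fst B) = (real k - real l - 1) / (real k - 1)"
    unfolding pair one_minus[symmetric] by simp
  fix p :: "nat \<Rightarrow> real"
  assume p: "\<forall>n\<ge>1. 0 \<le> p n \<and> p n \<le> 1 \<and> p n \<le> 1 / 64 * real n powr (- 1 / m_pair (fst A) (fst B))"
  have e: "- 1 / m_pair (fst A) (fst B) = - (1 - \<mu>)" unfolding pair by simp
  obtain V where V: "balanced \<mu> (fst A) V" using exists_balanced(2)[OF A(1,2) dA cA(1) \<mu>] by blast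
  obtain W where W: "balanced \<mu> (fst B) W" using exists_balanced(2)[OF B(1,2) dB cB(1) \<mu>] by blast
  show "(\<lambda>n. measure_pmf.prob (random_subset n (p n)) {S. rado A B S}) \<longlonglongrightarrow> 0"
    by (rule prob_rado_tendsto_0[OF V W]) (use p[unfolded e] in blast)
qed

end
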